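(* Let $T$ be a positive trace-class contraction on a Hilbert space. If $\varphi:[0,1]\to\mathbb{C}$ is a measurable function satisfying $\varphi(0)=0$ and \[ C_\varphi:=\sup_{0<t<1}\frac{|\varphi(t)-\varphi(1)t|}{t(1-t)}<\infty, \] then $\varphi(T)$ is trace-class and \[ |\operatorname{tr}(\varphi(T))-\varphi(1)\operatorname{tr}(T)|\leq C_\varphi\operatorname{tr}(T-T^2). \]
   Context: "Positive" means self-adjoint and positive semidefinite, and "contraction" means operator norm at most $1$. The operator $\varphi(T)$ is defined by the functional calculus for the self-adjoint operator $T$, whose spectrum lies in $[0,1]$; $\operatorname{tr}$ denotes the operator trace. *)

theory Defs
  imports "HOL-Analysis.Analysis"
begin

text \<open>Complex Hilbert spaces of arbitrary dimension (zero and non-separable included). The inner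
  product is conjugate-linear in its first argument.\<close>

class chilbert_space = banach +
  fixes scaleC :: "complex \<Rightarrow> 'a \<Rightarrow> 'a" (infixr "*\<^sub>C" 75)
    and cinner :: "'a \<Rightarrow> 'a \<Rightarrow> complex"
  assumes scaleC_add_right: "c *\<^sub>C (x + y) = c *\<^sub>C x + c *\<^sub>C y"
    and scaleC_add_left: "(c + d) *\<^sub>C x = c *\<^sub>C x + d *\<^sub>C x"
    and scaleC_scaleC: "c *\<^sub>C d *\<^sub>C x = (c * d) *\<^sub>C x"
    and scaleR_scaleC: "r *\<^sub>R x = complex_of_real r *\<^sub>C x"
    and cinner_commute: "cinner x y = cnj (cinner y x)"
    and cinner_add_right: "cinner x (y + z) = cinner x y + cinner x z"
    and cinner_scaleC_right: "cinner x (c *\<^sub>C y) = c * cinner x y"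
    and cinner_self: "cinner x x = complex_of_real ((norm x)\<^sup>2)"

instantiation complex :: chilbert_space
begin

definition "scaleC_complex (c::complex) (x::complex) = c * x"

definition "cinner_complex (x::complex) (y::complex) = cnj x * y"

instance
proof
  fix x :: complex
  show "cinner x x = complex_of_real ((norm x)\<^sup>2)"
    unfolding cinner_complex_def by (metis complex_norm_square mult.commute)
qed (simp_all add: scaleC_complex_def cinner_complex_def algebra_simps scaleR_conv_of_real)

end

definition bounded_clinear :: "('a::chilbert_space \<Rightarrow> 'a) \<Rightarrow> bool" where
  "bounded_clinear T \<longleftrightarrow> bounded_linear T \<and> (\<forall>c x. T (c *\<^sub>C x) = c *\<^sub>C T x)"

definition selfadjoint :: "('a::chilbert_space \<Rightarrow> 'a) \<Rightarrow> bool" where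
  "selfadjoint T \<longleftrightarrow> bounded_clinear T \<and> (\<forall>x y. cinner (T x) y = cinner x (T y))"

definition positive_op :: "('a::chilbert_space \<Rightarrow> 'a) \<Rightarrow> bool" where
  "positive_op T \<longleftrightarrow> selfadjoint T \<and> (\<forall>x. 0 \<le> Re (cinner x (T x)))"

definition cadjoint :: "('a::chilbert_space \<Rightarrow> 'a) \<Rightarrow> 'a \<Rightarrow> 'a" where
  "cadjoint T = (THE S. \<forall>x y. cinner (T x) y = cinner x (S y))"

definition abs_op :: "('a::chilbert_space \<Rightarrow> 'a) \<Rightarrow> 'a \<Rightarrow> 'a" where
  "abs_op T = (THE P. positive_op P \<and> P \<circ> P = cadjoint T \<circ> T)"

definition orthonormal :: "'a::chilbert_space set \<Rightarrow> bool" where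
  "orthonormal B \<longleftrightarrow>
     (\<forall>e\<in>B. norm e = 1) \<and> (\<forall>e\<in>B. \<forall>f\<in>B. e \<noteq> f \<longrightarrow> cinner e f = 0)"

definition orthonormal_basis :: "'a::chilbert_space set \<Rightarrow> bool" where
  "orthonormal_basis B \<longleftrightarrow> orthonormal B \<and> (\<forall>B'. orthonormal B' \<and> B \<subseteq> B' \<longrightarrow> B' = B)"

text \<open>The sum of the nonnegative diagonal entries of \<open>\<bar>T\<bar>\<close> does not depend on the basis, so
  finiteness for one basis is finiteness for all.\<close>

definition trace_class :: "('a::chilbert_space \<Rightarrow> 'a) \<Rightarrow> bool" where
  "trace_class T \<longleftrightarrow> bounded_clinear T \<and>
     (\<exists>B. orthonormal_basis B \<and> (\<lambda>e. cinner e (abs_op T e)) summable_on B)"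

definition op_trace :: "('a::chilbert_space \<Rightarrow> 'a) \<Rightarrow> complex" where
  "op_trace T = (THE z. \<forall>B. orthonormal_basis B \<longrightarrow> ((\<lambda>e. cinner e (T e)) has_sum z) B)"

definition spectrum :: "('a::chilbert_space \<Rightarrow> 'a) \<Rightarrow> complex set" where
  "spectrum T = {z. \<not> (\<exists>S. bounded_clinear S \<and>
     (\<forall>x. S (T x - z *\<^sub>C x) = x) \<and> (\<forall>x. T (S x) - z *\<^sub>C S x = x))}"

definition projection_valued_measure ::
    "'b measure \<Rightarrow> ('b set \<Rightarrow> 'a::chilbert_space \<Rightarrow> 'a) \<Rightarrow> bool" where
  "projection_valued_measure M E \<longleftrightarrow>
     (\<forall>A\<in>sets M. selfadjoint (E A) \<and> E A \<circ> E A = E A) \<and>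
     E {} = (\<lambda>x. 0) \<and> E (space M) = id \<and>
     (\<forall>A\<in>sets M. \<forall>B\<in>sets M. E (A \<inter> B) = E A \<circ> E B) \<and>
     (\<forall>A::nat \<Rightarrow> 'b set. range A \<subseteq> sets M \<and> disjoint_family A \<longrightarrow>
        (\<forall>x. (\<lambda>n. E (A n) x) sums E (\<Union>n. A n) x))"

text \<open>The scalar measure \<open>A \<mapsto> \<langle>x, E(A) x\<rangle>\<close>; these diagonal measures determine \<open>\<integral> f dE\<close>,
  since an operator on a complex Hilbert space is determined by its quadratic form.\<close>

definition scalar_measure ::
    "'b measure \<Rightarrow> ('b set \<Rightarrow> 'a::chilbert_space \<Rightarrow> 'a) \<Rightarrow> 'a \<Rightarrow> 'b measure" where
  "scalar_measure M E x =
     measure_of (space M) (sets M) (\<lambda>A. ennreal (Re (cinner x (E A x))))"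

definition has_operator_integral ::
    "'b measure \<Rightarrow> ('b set \<Rightarrow> 'a::chilbert_space \<Rightarrow> 'a) \<Rightarrow> ('b \<Rightarrow> complex) \<Rightarrow> ('a \<Rightarrow> 'a) \<Rightarrow> bool"
  where
  "has_operator_integral M E f S \<longleftrightarrow> bounded_clinear S \<and>
     (\<forall>x. integrable (scalar_measure M E x) f \<and>
          cinner x (S x) = integral\<^sup>L (scalar_measure M E x) f)"

text \<open>The Borel space on the spectrum of a self-adjoint operator, regarded as a subset of the
  real line.\<close>

definition spectrum_borel :: "('a::chilbert_space \<Rightarrow> 'a) \<Rightarrow> real measure" where
  "spectrum_borel T = restrict_space borel {t. complex_of_real t \<in> spectrum T}"

definition spectral_measure ::
    "('a::chilbert_space \<Rightarrow> 'a) \<Rightarrow> (real set \<Rightarrow> 'a \<Rightarrow> 'a) \<Rightarrow> bool" where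
  "spectral_measure T E \<longleftrightarrow> projection_valued_measure (spectrum_borel T) E \<and>
     has_operator_integral (spectrum_borel T) E complex_of_real T"

text \<open>The Borel functional calculus \<open>\<phi>(T) = \<integral> \<phi> dE\<close> of a self-adjoint operator. Only the values of
  \<open>\<phi>\<close> on the spectrum matter. The spectral measure is unique on Borel subsets of the spectrum.\<close>

definition functional_calculus ::
    "(real \<Rightarrow> complex) \<Rightarrow> ('a::chilbert_space \<Rightarrow> 'a) \<Rightarrow> 'a \<Rightarrow> 'a" where
  "functional_calculus \<phi> T =
     (THE S. \<exists>E. spectral_measure T E \<and> has_operator_integral (spectrum_borel T) E \<phi> S)"

definition C_quotient :: "(real \<Rightarrow> complex) \<Rightarrow> real \<Rightarrow> real" where
  "C_quotient \<phi> t = cmod (\<phi> t - \<phi> 1 * complex_of_real t) / (t * (1 - t))"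

text \<open>As a real supremum this is meaningful only when the quotient is bounded on \<open>(0,1)\<close>.\<close>

definition C_const :: "(real \<Rightarrow> complex) \<Rightarrow> real" where
  "C_const \<phi> = (SUP t\<in>{0<..<1}. C_quotient \<phi> t)"

end

theory Submission
  imports Defs
begin

text \<open>In an orthonormal basis of eigenvectors the inequality becomes a termwise estimate. A positive
  trace-class contraction \<open>T\<close> has such a basis \<open>B\<close>, with eigenvalues \<open>r(e) \<in> [0,1]\<close> of finite sum, and
  \<open>\<phi>(T)\<close> is the diagonal operator with entries \<open>\<phi>(r(e))\<close>. The hypotheses on \<open>\<phi>\<close> give
  \<open>\<bar>\<phi>(t) - \<phi>(1) t\<bar> \<le> C\<^sub>\<phi> (t - t\<^sup>2)\<close> for all \<open>t \<in> [0,1]\<close>. Hence \<open>\<bar>\<phi>(t)\<bar> \<le> (\<bar>\<phi>(1)\<bar> + C\<^sub>\<phi>) t\<close>, which makes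
  \<open>\<phi>(T)\<close> trace class, and summing over \<open>t = r(e)\<close> gives the inequality, because the trace of a diagonal
  operator is the sum of its entries.

  Four facts carry this argument.

  \<^item> The absolute value of an operator is determined by its square, since a positive operator has at
    most one positive square root (\<open>positive_op_square_inj\<close>). So \<open>\<bar>T\<bar> = T\<close>, and the absolute value of
    a diagonal operator is found by taking absolute values of the entries.

  \<^item> \<open>T\<close> is Hilbert-Schmidt and therefore diagonalizable (\<open>positive_Hilbert_Schmidt_eigenbasis\<close>).
    An eigenvector is produced by iterating a nonzero compression of \<open>T\<close>, scaled to norm \<open>1\<close>: its even powers converge strongly, and the
    Hilbert-Schmidt condition prevents all the limits from being zero.

  \<^item> A spectral measure of \<open>T\<close> is given by the projections \<open>E(A)\<close> onto the closed span of the basis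
    vectors \<open>e\<close> with \<open>r(e) \<in> A\<close>. For any spectral measure whatsoever, \<open>\<integral> \<phi> dE\<close> maps an eigenvector \<open>e\<close>
    for the eigenvalue \<open>l\<close> to \<open>\<phi>(l) e\<close> (\<open>operator_integral_eigenvector\<close>), and a bounded operator is
    determined by its values on \<open>B\<close>.

  \<^item> The trace is the same in every orthonormal basis: by Parseval, the two iterated sums of
    \<open>f(b) \<bar>\<langle>b, e\<rangle>\<bar>\<^sup>2\<close> are the traces in the two bases (\<open>diag_op_trace\<close>).\<close>

section \<open>Inner product algebra\<close>

lemma scaleC_zero_left [simp]: "0 *\<^sub>C (x::'a::chilbert_space) = 0"
  using scaleC_add_left[of 0 0 x] by simp

lemma scaleC_zero_right [simp]: "c *\<^sub>C (0::'a::chilbert_space) = 0"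
  using scaleC_add_right[of c "0::'a" 0] by simp

lemma scaleC_one [simp]: "1 *\<^sub>C (x::'a::chilbert_space) = x"
  using scaleR_scaleC[of 1 x] by simp

lemma scaleC_minus_left: "(- c) *\<^sub>C (x::'a::chilbert_space) = - (c *\<^sub>C x)"
  using scaleC_add_left[of c "- c" x] by (simp add: eq_neg_iff_add_eq_0 add.commute)

lemma scaleC_minus_right: "c *\<^sub>C (- x::'a::chilbert_space) = - (c *\<^sub>C x)"
  using scaleC_add_right[of c x "- x"] by (simp add: eq_neg_iff_add_eq_0 add.commute)

lemma scaleC_diff_left: "(c - d) *\<^sub>C (x::'a::chilbert_space) = c *\<^sub>C x - d *\<^sub>C x"
  using scaleC_add_left[of c "- d" x] by (simp add: scaleC_minus_left)

lemma scaleC_diff_right: "c *\<^sub>C (x - y::'a::chilbert_space) = c *\<^sub>C x - c *\<^sub>C y"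
  using scaleC_add_right[of c x "- y"] by (simp add: scaleC_minus_right)

lemma cinner_add_left: "cinner (x + y) z = cinner x z + cinner (y::'a::chilbert_space) z"
  by (metis cinner_add_right cinner_commute complex_cnj_add)

lemma cinner_scaleC_left: "cinner (c *\<^sub>C x) y = cnj c * cinner x (y::'a::chilbert_space)"
  by (metis cinner_scaleC_right cinner_commute complex_cnj_mult)

lemma cinner_zero_right [simp]: "cinner x (0::'a::chilbert_space) = 0"
  using cinner_add_right[of x "0::'a" 0] by simp

lemma cinner_zero_left [simp]: "cinner (0::'a::chilbert_space) x = 0"
  using cinner_add_left[of "0::'a" 0 x] by simp

lemma cinner_minus_right: "cinner x (- y) = - cinner x (y::'a::chilbert_space)"
  using cinner_add_right[of x y "- y"] by (simp add: eq_neg_iff_add_eq_0 add.commute)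

lemma cinner_minus_left: "cinner (- x) y = - cinner x (y::'a::chilbert_space)"
  using cinner_add_left[of x "- x" y] by (simp add: eq_neg_iff_add_eq_0 add.commute)

lemma cinner_diff_right: "cinner x (y - z) = cinner x y - cinner x (z::'a::chilbert_space)"
  using cinner_add_right[of x y "- z"] by (simp add: cinner_minus_right)

lemma cinner_diff_left: "cinner (x - y) z = cinner x z - cinner (y::'a::chilbert_space) z"
  using cinner_add_left[of x "- y" z] by (simp add: cinner_minus_left)

lemmas cinner_simps = cinner_add_left cinner_add_right cinner_diff_left cinner_diff_right
  cinner_minus_left cinner_minus_right cinner_scaleC_left cinner_scaleC_right

lemma cinner_sum_right: "cinner x (\<Sum>i\<in>F. f i) = (\<Sum>i\<in>F. cinner x (f i :: 'a::chilbert_space))"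
  by (induction F rule: infinite_finite_induct) (simp_all add: cinner_add_right)

lemma norm_sq_cinner: "(norm x)\<^sup>2 = Re (cinner x (x::'a::chilbert_space))"
  by (simp add: cinner_self)

lemma cinner_self_eq_0_iff [simp]: "cinner x x = 0 \<longleftrightarrow> x = (0::'a::chilbert_space)"
  by (simp add: cinner_self)

lemma norm_add_sq:
  "(norm (x + y))\<^sup>2 = (norm x)\<^sup>2 + 2 * Re (cinner x y) + (norm (y::'a::chilbert_space))\<^sup>2"
proof -
  have "Re (cinner y x) = Re (cinner x y)"
    by (metis cinner_commute complex_cnj_cnj cnj.simps(1))
  then show ?thesis
    by (simp add: norm_sq_cinner cinner_add_left cinner_add_right)
qed

lemma norm_diff_sq:
  "(norm (x - y))\<^sup>2 = (norm x)\<^sup>2 - 2 * Re (cinner x y) + (norm (y::'a::chilbert_space))\<^sup>2"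
  using norm_add_sq[of x "- y"] by (simp add: cinner_minus_right)

lemma norm_scaleC: "norm (c *\<^sub>C x) = cmod c * norm (x::'a::chilbert_space)"
proof -
  have "complex_of_real ((norm (c *\<^sub>C x))\<^sup>2) = cnj c * c * cinner x x"
    by (metis cinner_self cinner_scaleC_left cinner_scaleC_right mult.assoc mult.left_commute)
  also have "\<dots> = complex_of_real ((cmod c * norm x)\<^sup>2)"
    by (metis cinner_self complex_norm_square mult.commute of_real_mult power_mult_distrib)
  finally have "(norm (c *\<^sub>C x))\<^sup>2 = (cmod c * norm x)\<^sup>2"
    by (simp only: of_real_eq_iff)
  then show ?thesis by simp
qed

lemma bounded_linear_scaleC_right: "bounded_linear (\<lambda>x. c *\<^sub>C (x::'a::chilbert_space))"
  by (rule bounded_linear_intro[where K="cmod c"])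
     (simp_all add: scaleC_add_right norm_scaleC scaleR_scaleC scaleC_scaleC mult.commute)

section \<open>Bounded, self-adjoint and positive operators\<close>

lemma bounded_clinearD:
  assumes "bounded_clinear T"
  shows "bounded_linear T" "T (x + y) = T x + T y" "T (x - y) = T x - T y" "T (- x) = - T x"
    "T 0 = 0" "T (c *\<^sub>C x) = c *\<^sub>C T x" "T (r *\<^sub>R x) = r *\<^sub>R T x"
proof -
  from assms show bl: "bounded_linear T" and "T (c *\<^sub>C x) = c *\<^sub>C T x"
    by (auto simp: bounded_clinear_def)
  from bl interpret bounded_linear T .
  show "T (x + y) = T x + T y" "T (x - y) = T x - T y" "T (- x) = - T x" "T 0 = 0"
    "T (r *\<^sub>R x) = r *\<^sub>R T x"
    by (simp_all add: add diff neg zero scaleR)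
qed

lemma selfadjointD:
  assumes "selfadjoint T"
  shows "bounded_clinear T" "cinner (T x) y = cinner x (T y)"
  using assms by (auto simp: selfadjoint_def)

lemma positive_opD:
  assumes "positive_op T"
  shows "selfadjoint T" "bounded_clinear T" "cinner (T x) y = cinner x (T y)"
    "0 \<le> Re (cinner x (T x))"
  using assms by (auto simp: positive_op_def selfadjoint_def)

lemma bounded_clinear_id [simp]: "bounded_clinear (\<lambda>x. x)"
  by (simp add: bounded_clinear_def bounded_linear_ident)

lemma bounded_clinear_compose:
  "bounded_clinear S \<Longrightarrow> bounded_clinear T \<Longrightarrow> bounded_clinear (\<lambda>x. S (T x))"
  by (auto simp: bounded_clinear_def intro: bounded_linear_compose)

lemma bounded_clinear_add:
  "bounded_clinear S \<Longrightarrow> bounded_clinear T \<Longrightarrow> bounded_clinear (\<lambda>x. S x + T x)"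
  by (auto simp: bounded_clinear_def scaleC_add_right intro: bounded_linear_add)

lemma bounded_clinear_diff:
  "bounded_clinear S \<Longrightarrow> bounded_clinear T \<Longrightarrow> bounded_clinear (\<lambda>x. S x - T x)"
  by (auto simp: bounded_clinear_def scaleC_diff_right intro: bounded_linear_sub)

lemma bounded_clinear_scaleC:
  "bounded_clinear S \<Longrightarrow> bounded_clinear (\<lambda>x. c *\<^sub>C S x)"
  by (auto simp: bounded_clinear_def scaleC_scaleC mult.commute
      intro: bounded_linear_compose[OF bounded_linear_scaleC_right])

lemma positive_op_add:
  "positive_op S \<Longrightarrow> positive_op T \<Longrightarrow> positive_op (\<lambda>x. S x + T x)"
  by (auto simp: positive_op_def selfadjoint_def cinner_simps bounded_clinear_add)

lemma positive_op_scaleC: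
  assumes "positive_op S" "0 \<le> r"
  shows "positive_op (\<lambda>x. complex_of_real r *\<^sub>C S x)"
  using assms by (auto simp: positive_op_def selfadjoint_def cinner_simps bounded_clinear_scaleC)

text \<open>The Cauchy-Schwarz inequality is needed for the degenerate forms \<open>\<langle>x, A y\<rangle>\<close> as well as
  for the inner product itself: evaluate the form at \<open>x - t \<langle>y, A x\<rangle> y\<close> for real \<open>t\<close>.\<close>

lemma positive_op_Cauchy_Schwarz:
  assumes "positive_op A"
  shows "(cmod (cinner x (A y)))\<^sup>2 \<le> Re (cinner x (A x)) * Re (cinner y (A y))"
proof -
  define a b c where "a = Re (cinner x (A x))" and "b = Re (cinner y (A y))"
    and "c = cinner x (A y)"
  note A = positive_opD[OF assms]
  have c': "cinner y (A x) = cnj c"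
    unfolding c_def by (metis A(3) cinner_commute)
  have q: "0 \<le> a - 2 * t * (cmod c)\<^sup>2 + t\<^sup>2 * (cmod c)\<^sup>2 * b" for t :: real
  proof -
    define s where "s = - complex_of_real t * cnj c"
    have cc: "c * cnj c = complex_of_real ((cmod c)\<^sup>2)"
      by (rule complex_norm_square[symmetric])
    have "cinner (x + s *\<^sub>C y) (A (x + s *\<^sub>C y))
        = cinner x (A x) + s * c + cnj s * cnj c + cnj s * s * cinner y (A y)"
      by (simp add: cinner_simps bounded_clinearD[OF A(2)] c' c_def[symmetric] algebra_simps)
    moreover have "s * c = - complex_of_real (t * (cmod c)\<^sup>2)"
      using cc by (simp add: s_def mult_ac del: of_real_power)
    moreover have "cnj s * cnj c = - complex_of_real (t * (cmod c)\<^sup>2)"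
      using cc by (simp add: s_def mult_ac del: of_real_power)
    moreover have "cnj s * s = complex_of_real (t\<^sup>2 * (cmod c)\<^sup>2)"
      using cc by (simp add: s_def power2_eq_square[of t] mult_ac del: of_real_power)
    ultimately have "Re (cinner (x + s *\<^sub>C y) (A (x + s *\<^sub>C y)))
        = a - t * (cmod c)\<^sup>2 - t * (cmod c)\<^sup>2 + t\<^sup>2 * (cmod c)\<^sup>2 * b"
      by (simp add: a_def b_def del: of_real_mult of_real_power)
    with A(4)[of "x + s *\<^sub>C y"] show ?thesis by simp
  qed
  have "0 \<le> a" "0 \<le> b"
    by (simp_all add: a_def b_def A)
  have "(cmod c)\<^sup>2 \<le> a * b"
  proof (cases "b = 0")
    case True
    show ?thesis
    proof (cases "c = 0")
      case False
      have "0 \<le> a - 2 * ((a + 1) / (2 * (cmod c)\<^sup>2)) * (cmod c)\<^sup>2"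
        using q[of "(a + 1) / (2 * (cmod c)\<^sup>2)"] True by simp
      with False show ?thesis by simp
    qed (use True in simp)
  next
    case False
    with q[of "1 / b"] have "0 \<le> a - (cmod c)\<^sup>2 / b"
      by (simp add: power2_eq_square field_simps)
    with False \<open>0 \<le> b\<close> show ?thesis
      by (simp add: field_simps)
  qed
  then show ?thesis by (simp add: a_def b_def c_def)
qed

lemma Cauchy_Schwarz: "cmod (cinner x y) \<le> norm x * norm (y::'a::chilbert_space)"
proof (rule power2_le_imp_le)
  have "positive_op (\<lambda>x::'a. x)"
    by (simp add: positive_op_def selfadjoint_def cinner_self)
  from positive_op_Cauchy_Schwarz[OF this, of x y]
  show "(cmod (cinner x y))\<^sup>2 \<le> (norm x * norm y)\<^sup>2"
    by (simp add: cinner_self power_mult_distrib)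
qed simp

lemma bounded_linear_cinner_right: "bounded_linear (\<lambda>y. cinner x (y::'a::chilbert_space))"
  by (rule bounded_linear_intro[where K="norm x"])
     (use Cauchy_Schwarz[of x] in \<open>simp_all add: cinner_add_right scaleR_scaleC cinner_scaleC_right
        scaleC_complex_def mult.commute\<close>)

text \<open>This refines \<open>\<parallel>A x\<parallel> \<le> K \<parallel>x\<parallel>\<close>: it is the inequality \<open>A\<^sup>2 \<le> K A\<close>.\<close>

lemma positive_op_norm_sq_le:
  assumes "positive_op A" and K: "\<And>x. norm (A x) \<le> K * norm x"
  shows "(norm (A x))\<^sup>2 \<le> K * Re (cinner x (A x))"
proof (cases "A x = 0")
  case True
  then show ?thesis by simp
next
  case False
  note A = positive_opD[OF assms(1)]
  have "(norm (A x))\<^sup>2 * (norm (A x))\<^sup>2 = (cmod (cinner (A x) (A x)))\<^sup>2"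
    by (simp only: cinner_self norm_of_real abs_of_nonneg[OF zero_le_power2])
       (simp only: power2_eq_square)
  also have "\<dots> \<le> Re (cinner (A x) (A (A x))) * Re (cinner x (A x))"
    using positive_op_Cauchy_Schwarz[OF assms(1), of "A x" x] by simp
  also have "\<dots> \<le> (norm (A x) * (K * norm (A x))) * Re (cinner x (A x))"
  proof (rule mult_right_mono[OF _ A(4)])
    have "Re (cinner (A x) (A (A x))) \<le> norm (A x) * norm (A (A x))"
      using Cauchy_Schwarz complex_Re_le_cmod order_trans by blast
    also have "\<dots> \<le> norm (A x) * (K * norm (A x))"
      by (intro mult_left_mono K) simp
    finally show "Re (cinner (A x) (A (A x))) \<le> norm (A x) * (K * norm (A x))" .
  qed
  finally have "(norm (A x))\<^sup>2 * (norm (A x))\<^sup>2 \<le> (norm (A x))\<^sup>2 * (K * Re (cinner x (A x)))"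
    by (metis (no_types) mult.assoc mult.commute power2_eq_square)
  then show ?thesis
    by (rule mult_left_le_imp_le) (simp add: False)
qed

lemma positive_op_form_zeroD:
  assumes "positive_op A" "Re (cinner x (A x)) = 0"
  shows "A x = 0"
  using positive_op_Cauchy_Schwarz[OF assms(1), of "A x" x] assms(2) by simp

text \<open>Polarization: expand the form at \<open>x + y\<close> and at \<open>x + \<i> y\<close>.\<close>

lemma clinear_eq_zeroI:
  assumes S: "bounded_clinear S" and 0: "\<And>x. cinner x (S x) = 0"
  shows "S x = 0"
proof -
  note S = bounded_clinearD[OF S]
  have "cinner x (S y) = 0" for x y
  proof -
    have "cinner x (S y) + cinner y (S x) = 0"
      using 0[of "x + y"] 0[of x] 0[of y] by (simp add: S cinner_simps add.commute)
    moreover have "\<i> * cinner x (S y) - \<i> * cinner y (S x) = 0"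
      using 0[of "x + \<i> *\<^sub>C y"] 0[of x] 0[of y] by (simp add: S cinner_simps)
    ultimately show ?thesis by (simp add: add_eq_0_iff)
  qed
  from this[of "S x" x] show ?thesis by simp
qed

lemma clinear_eqI:
  assumes "bounded_clinear S" "bounded_clinear S'" "\<And>x. cinner x (S x) = cinner x (S' x)"
  shows "S = S'"
proof
  fix x
  have "S x - S' x = 0"
    by (rule clinear_eq_zeroI[of "\<lambda>x. S x - S' x"])
       (simp_all add: assms bounded_clinear_diff cinner_simps)
  then show "S x = S' x" by simp
qed

section \<open>Uniqueness of positive square roots\<close>

text \<open>Since \<open>D\<close> intertwines \<open>1 - A\<close> with \<open>1 + A\<close> and the powers of \<open>1 - A\<close> are contractions, the
  powers of \<open>1 + A\<close> stay bounded on the range of \<open>D\<close>; but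
  \<open>\<parallel>(1 + A)\<^sup>n y\<parallel>\<^sup>2 \<ge> \<parallel>y\<parallel>\<^sup>2 + 2 n \<langle>y, A y\<rangle>\<close>, so \<open>\<langle>y, A y\<rangle> = 0\<close> there.\<close>

lemma positive_contraction_anticommute_zero:
  assumes "positive_op A" and contr: "\<And>x. norm (A x) \<le> norm x"
    and D: "bounded_clinear D" and anti: "\<And>x. A (D x) = - D (A x)"
  shows "A (D x) = 0"
proof -
  note A = positive_opD[OF assms(1)]
  note Al = bounded_clinearD[OF A(2)] and Dl = bounded_clinearD[OF D]
  define y where "y = D x"
  define Bp Bm where "Bp = (\<lambda>x. x + A x)" and "Bm = (\<lambda>x. x - A x)"
  define u v where "u = (\<lambda>n. (Bp ^^ n) y)" and "v = (\<lambda>n. (Bm ^^ n) x)"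
  have sqA: "(norm (A x))\<^sup>2 \<le> Re (cinner x (A x))" for x
    using positive_op_norm_sq_le[OF assms(1), of 1] contr by simp
  have Dv: "D (v n) = u n" for n
    by (induction n) (auto simp: u_def v_def y_def Bp_def Bm_def Dl anti[symmetric])
  have Bm_le: "norm (Bm z) \<le> norm z" for z
  proof (rule power2_le_imp_le)
    show "(norm (Bm z))\<^sup>2 \<le> (norm z)\<^sup>2"
      using sqA[of z] A(4)[of z] by (simp add: Bm_def norm_diff_sq)
  qed simp
  have v_le: "norm (v n) \<le> norm x" for n
    by (induction n) (auto simp: v_def intro: order_trans[OF Bm_le])
  obtain K where K: "\<And>x. norm (D x) \<le> norm x * K"
    using Dl(1) bounded_linear.bounded by blast
  then have u_le: "norm (u n) \<le> norm x * \<bar>K\<bar>" for n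
  proof -
    have "norm (u n) \<le> norm (v n) * K" using K[of "v n"] by (simp add: Dv)
    also have "\<dots> \<le> norm (v n) * \<bar>K\<bar>" by (simp add: mult_left_mono)
    also have "\<dots> \<le> norm x * \<bar>K\<bar>" by (simp add: mult_right_mono v_le)
    finally show ?thesis .
  qed
  define g where "g = Re (cinner y (A y))"
  have g0: "0 \<le> g" by (simp add: g_def A)
  have g_le: "g \<le> Re (cinner (u n) (A (u n)))" for n
  proof (induction n)
    case 0
    show ?case by (simp add: u_def g_def)
  next
    case (Suc n)
    let ?z = "u n"
    have "Re (cinner (Bp ?z) (A (Bp ?z)))
        = Re (cinner ?z (A ?z)) + 2 * (norm (A ?z))\<^sup>2 + Re (cinner (A ?z) (A (A ?z)))"
      by (simp add: Bp_def Al cinner_simps A(3)[symmetric] norm_sq_cinner)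
    with Suc A(4)[of "A ?z"] have "g \<le> Re (cinner (Bp ?z) (A (Bp ?z)))"
      using zero_le_power2[of "norm (A ?z)"] by linarith
    then show ?case by (simp add: u_def)
  qed
  have growth: "(norm y)\<^sup>2 + 2 * real n * g \<le> (norm (u n))\<^sup>2" for n
  proof (induction n)
    case 0
    show ?case by (simp add: u_def)
  next
    case (Suc n)
    have "(norm (u (Suc n)))\<^sup>2
        = (norm (u n))\<^sup>2 + 2 * Re (cinner (u n) (A (u n))) + (norm (A (u n)))\<^sup>2"
      by (simp add: u_def Bp_def norm_add_sq)
    moreover have "2 * real (Suc n) * g = 2 * real n * g + 2 * g"
      by (simp add: algebra_simps)
    ultimately show ?case
      using Suc g_le[of n] zero_le_power2[of "norm (A (u n))"] by linarith
  qed
  have bd: "real n * (2 * g) \<le> (norm x * \<bar>K\<bar>)\<^sup>2" for n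
  proof -
    have "(norm (u n))\<^sup>2 \<le> (norm x * \<bar>K\<bar>)\<^sup>2"
      by (intro power_mono u_le) simp
    with growth[of n] zero_le_power2[of "norm y"] have "2 * real n * g \<le> (norm x * \<bar>K\<bar>)\<^sup>2"
      by linarith
    then show ?thesis by (simp add: mult_ac)
  qed
  have "g = 0"
  proof (rule ccontr)
    assume "g \<noteq> 0"
    with g0 have "0 < 2 * g" by simp
    from reals_Archimedean3[OF this] obtain n where "(norm x * \<bar>K\<bar>)\<^sup>2 < real n * (2 * g)"
      by blast
    with bd[of n] show False by simp
  qed
  then show ?thesis
    using positive_op_form_zeroD[OF assms(1), of y] by (simp add: g_def y_def)
qed

text \<open>If \<open>P\<^sup>2 = Q\<^sup>2\<close>, then \<open>P + Q\<close> anticommutes with \<open>D = P - Q\<close>, so the previous lemma gives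
  \<open>(P + Q) D = 0\<close>; positivity of both summands then gives \<open>P D = Q D = 0\<close> and \<open>D\<^sup>2 = 0\<close>.\<close>

lemma positive_op_square_inj:
  assumes P: "positive_op P" and Q: "positive_op Q" and eq: "P \<circ> P = Q \<circ> Q"
  shows "P = Q"
proof
  fix x
  note P = P positive_opD[OF P] and Q = Q positive_opD[OF Q]
  note Pl = bounded_clinearD[OF P(3)] and Ql = bounded_clinearD[OF Q(3)]
  define S D where "S = (\<lambda>x. P x + Q x)" and "D = (\<lambda>x. P x - Q x)"
  have eq': "P (P x) = Q (Q x)" for x
    using eq by (metis comp_apply)
  have S: "positive_op S"
    unfolding S_def by (rule positive_op_add[OF P(1) Q(1)])
  have D: "bounded_clinear D"
    unfolding D_def by (rule bounded_clinear_diff[OF P(3) Q(3)])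
  have anti: "S (D x) = - D (S x)" for x
    by (simp add: S_def D_def Pl Ql eq')
  obtain K where K: "\<And>x. norm (S x) \<le> norm x * K" "0 < K"
    using bounded_linear.pos_bounded[OF bounded_clinearD(1)[OF positive_opD(2)[OF S]]] by blast
  \<comment> \<open>Rescaling makes \<open>S\<close> a contraction.\<close>
  define A where "A = (\<lambda>x. complex_of_real (1 / K) *\<^sub>C S x)"
  have "A (D z) = 0" for z
  proof (rule positive_contraction_anticommute_zero[OF _ _ D])
    show "positive_op A"
      unfolding A_def using K by (intro positive_op_scaleC S) simp
    show "norm (A x) \<le> norm x" for x
      using K(1)[of x] K(2) by (simp add: A_def norm_scaleC norm_divide field_simps)
    show "A (D x) = - D (A x)" for x
      by (simp add: A_def anti bounded_clinearD[OF D] scaleC_minus_right)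
  qed
  then have "norm (A (D z)) = 0" for z by simp
  then have SD: "S (D z) = 0" for z
    using K(2) by (simp add: A_def norm_scaleC norm_divide)
  define y where "y = D x"
  have "Re (cinner y (P y)) + Re (cinner y (Q y)) = Re (cinner y (S y))"
    by (simp add: S_def cinner_add_right)
  also have "\<dots> = 0" by (simp add: y_def SD)
  finally have "Re (cinner y (P y)) = 0" "Re (cinner y (Q y)) = 0"
    using P(5)[of y] Q(5)[of y] by linarith+
  then have "P y = 0" "Q y = 0"
    using positive_op_form_zeroD P(1) Q(1) by blast+
  then have "cinner y y = 0"
    by (simp add: y_def D_def cinner_diff_left P(4) Q(4))
  then show "P x = Q x"
    by (simp add: y_def D_def)
qed

lemma cadjoint_eqI:
  assumes "\<And>x y. cinner (T x) y = cinner x (S y)"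
  shows "cadjoint T = S"
  unfolding cadjoint_def
proof (rule the_equality)
  show "\<forall>x y. cinner (T x) y = cinner x (S y)" using assms by blast
  fix S' assume S': "\<forall>x y. cinner (T x) y = cinner x (S' y)"
  show "S' = S"
  proof
    fix y
    have "cinner (S' y - S y) (S' y - S y) = 0"
      using S' assms by (metis cinner_diff_right diff_self)
    then show "S' y = S y" by simp
  qed
qed

lemma abs_op_eqI:
  assumes "\<And>x y. cinner (T x) y = cinner x (S y)" "positive_op P" "P \<circ> P = S \<circ> T"
  shows "abs_op T = P"
  unfolding abs_op_def cadjoint_eqI[OF assms(1)]
proof (rule the_equality)
  show "P' = P" if "positive_op P' \<and> P' \<circ> P' = S \<circ> T" for P'
    by (rule positive_op_square_inj) (use that assms in simp_all)
qed (use assms in simp)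

lemma abs_op_positive: "positive_op T \<Longrightarrow> abs_op T = T"
  by (rule abs_op_eqI[where S=T]) (simp_all add: positive_opD)

section \<open>Orthonormal bases\<close>

lemma orthonormal_cinner:
  "orthonormal B \<Longrightarrow> e \<in> B \<Longrightarrow> e' \<in> B \<Longrightarrow> cinner e e' = (if e = e' then 1 else 0)"
  by (auto simp: orthonormal_def cinner_self)

lemma orthonormal_basis_imp_orthonormal: "orthonormal_basis B \<Longrightarrow> orthonormal B"
  by (simp add: orthonormal_basis_def)

lemma orthonormal_sum_coeff:
  assumes "orthonormal B" "finite F" "F \<subseteq> B" "e \<in> B"
  shows "cinner e (\<Sum>i\<in>F. c i *\<^sub>C i) = (if e \<in> F then c e else 0)"
proof -
  have "cinner e (\<Sum>i\<in>F. c i *\<^sub>C i) = (\<Sum>i\<in>F. if i = e then c i else 0)"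
    unfolding cinner_sum_right
    by (intro sum.cong) (use assms in \<open>auto simp: cinner_scaleC_right orthonormal_cinner\<close>)
  then show ?thesis using assms(2) by simp
qed

lemma orthonormal_norm_sum:
  assumes "orthonormal B" "finite F" "F \<subseteq> B"
  shows "(norm (\<Sum>i\<in>F. c i *\<^sub>C i))\<^sup>2 = (\<Sum>i\<in>F. (cmod (c i))\<^sup>2)"
  using assms(2,3)
proof (induction F)
  case (insert e F)
  have "cinner (c e *\<^sub>C e) (\<Sum>i\<in>F. c i *\<^sub>C i) = 0"
    using insert orthonormal_sum_coeff[OF assms(1), of F e c] by (simp add: cinner_scaleC_left)
  moreover have "norm e = 1" using insert assms(1) by (auto simp: orthonormal_def)
  ultimately show ?case
    using insert by (simp add: norm_add_sq norm_scaleC)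
qed simp

lemma orthonormal_Bessel_finite:
  assumes "orthonormal B" "finite F" "F \<subseteq> B"
  shows "(\<Sum>e\<in>F. (cmod (cinner e x))\<^sup>2) \<le> (norm x)\<^sup>2"
proof -
  let ?y = "\<Sum>e\<in>F. cinner e x *\<^sub>C e"
  have "cinner x ?y = (\<Sum>e\<in>F. complex_of_real ((cmod (cinner e x))\<^sup>2))"
    unfolding cinner_sum_right
  proof (rule sum.cong)
    fix e
    have "cinner x e = cnj (cinner e x)" by (rule cinner_commute)
    then show "cinner x (cinner e x *\<^sub>C e) = complex_of_real ((cmod (cinner e x))\<^sup>2)"
      by (simp only: cinner_scaleC_right complex_norm_square)
  qed simp
  then have "Re (cinner x ?y) = (\<Sum>e\<in>F. (cmod (cinner e x))\<^sup>2)"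
    by (simp del: of_real_power)
  moreover have "(norm ?y)\<^sup>2 = (\<Sum>e\<in>F. (cmod (cinner e x))\<^sup>2)"
    by (rule orthonormal_norm_sum[OF assms])
  moreover have "0 \<le> (norm (x - ?y))\<^sup>2" by simp
  ultimately show ?thesis by (simp add: norm_diff_sq)
qed

lemma orthonormal_Bessel_summable:
  assumes "orthonormal B"
  shows "(\<lambda>e. (cmod (cinner e x))\<^sup>2) summable_on B"
proof (rule nonneg_bdd_above_summable_on)
  show "bdd_above (sum (\<lambda>e. (cmod (cinner e x))\<^sup>2) ` {F. F \<subseteq> B \<and> finite F})"
    using orthonormal_Bessel_finite[OF assms] by (intro bdd_aboveI[of _ "(norm x)\<^sup>2"]) auto
qed simp

text \<open>Completeness enters here: by Pythagoras the partial sums form a Cauchy net.\<close>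

lemma orthonormal_series_summable:
  assumes B: "orthonormal B" and sq: "(\<lambda>e. (cmod (c e))\<^sup>2) summable_on B"
  shows "(\<lambda>e. c e *\<^sub>C e) summable_on (B :: 'a::chilbert_space set)"
proof -
  let ?s = "sum (\<lambda>e. c e *\<^sub>C e)" and ?q = "sum (\<lambda>e. (cmod (c e))\<^sup>2)"
  from sq obtain L where L: "(?q \<longlongrightarrow> L) (finite_subsets_at_top B)"
    unfolding summable_on_def has_sum_def by blast
  have "\<exists>P. eventually P (finite_subsets_at_top B) \<and>
          (\<forall>F F'. P F \<and> P F' \<longrightarrow> dist (?s F) (?s F') < r)" if "0 < r" for r
  proof -
    define d where "d = r\<^sup>2 / 8"
    have "0 < d" using that by (simp add: d_def)
    with L have "eventually (\<lambda>F. dist (?q F) L < d) (finite_subsets_at_top B)"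
      by (simp add: tendsto_iff)
    then obtain F0 where "finite F0 \<and> F0 \<subseteq> B \<and>
        (\<forall>F. finite F \<and> F0 \<subseteq> F \<and> F \<subseteq> B \<longrightarrow> dist (?q F) L < d)"
      unfolding eventually_finite_subsets_at_top by (elim exE) (rule that)
    then have F0: "finite F0" "F0 \<subseteq> B"
      and q: "\<And>F. finite F \<Longrightarrow> F0 \<subseteq> F \<Longrightarrow> F \<subseteq> B \<Longrightarrow> dist (?q F) L < d"
      by simp_all
    define P where "P F \<longleftrightarrow> finite F \<and> F0 \<subseteq> F \<and> F \<subseteq> B" for F
    have near: "dist (?s F) (?s F0) < r / 2" if "P F" for F
    proof -
      have F: "finite F" "F0 \<subseteq> F" "F \<subseteq> B" using that by (auto simp: P_def)
      have "(dist (?s F) (?s F0))\<^sup>2 = (norm (?s (F - F0)))\<^sup>2"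
        unfolding dist_norm using sum_diff[OF F(1,2), of "\<lambda>e. c e *\<^sub>C e"] by simp
      also have "\<dots> = ?q (F - F0)"
        by (rule orthonormal_norm_sum[OF B]) (use F in auto)
      also have "\<dots> = ?q F - ?q F0"
        by (rule sum_diff[OF F(1,2)])
      also have "\<dots> < 2 * d"
        using q[OF F] q[of F0] F0 by (simp add: dist_real_def)
      also have "\<dots> = (r / 2)\<^sup>2" by (simp add: d_def power2_eq_square)
      finally show ?thesis
        by (rule power2_less_imp_less) (use \<open>0 < r\<close> in simp)
    qed
    have "eventually P (finite_subsets_at_top B)"
      unfolding eventually_finite_subsets_at_top P_def using F0 by blast
    moreover have "dist (?s F) (?s F') < r" if "P F" "P F'" for F F'
      using near[OF that(1)] near[OF that(2)] dist_triangle2[of "?s F" "?s F'" "?s F0"] by linarith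
    ultimately show ?thesis by blast
  qed
  then have "cauchy_filter (filtermap ?s (finite_subsets_at_top B))"
    by (simp add: cauchy_filter_metric_filtermap)
  moreover have "complete (UNIV :: 'a set)"
    by (meson Cauchy_convergent UNIV_I complete_def convergent_def)
  ultimately obtain y where "(?s \<longlongrightarrow> y) (finite_subsets_at_top B)"
    using complete_uniform[where S="UNIV :: 'a set"] by (force simp add: filterlim_def)
  then show ?thesis
    unfolding summable_on_def has_sum_def by blast
qed

lemma orthonormal_series_coeff:
  assumes "orthonormal B" "((\<lambda>e. c e *\<^sub>C e) has_sum y) B" "e \<in> B"
  shows "cinner e y = c e"
proof -
  have "((\<lambda>i. cinner e (c i *\<^sub>C i)) has_sum cinner e y) B"
    by (rule has_sum_bounded_linear[OF bounded_linear_cinner_right assms(2)])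
  moreover have "((\<lambda>i. cinner e (c i *\<^sub>C i)) has_sum c e) B"
    by (rule has_sum_finite_neutralI[of "{e}"])
       (use assms in \<open>auto simp: cinner_scaleC_right orthonormal_cinner\<close>)
  ultimately show ?thesis by (rule has_sum_unique)
qed

lemma orthonormal_insert_normalized:
  assumes "orthonormal B" "z \<noteq> 0" and perp: "\<And>e. e \<in> B \<Longrightarrow> cinner e z = 0"
  shows "orthonormal (insert (inverse (norm z) *\<^sub>R z) B)" "inverse (norm z) *\<^sub>R z \<notin> B"
proof -
  define u where "u = inverse (norm z) *\<^sub>R z"
  have u: "norm u = 1" using assms(2) by (simp add: u_def)
  have eu: "cinner e u = 0" if "e \<in> B" for e
    using perp[OF that] by (simp add: u_def scaleR_scaleC cinner_scaleC_right)
  moreover have "cinner u e = 0" if "e \<in> B" for e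
    using eu[OF that] by (metis cinner_commute complex_cnj_zero)
  ultimately show "orthonormal (insert (inverse (norm z) *\<^sub>R z) B)"
    unfolding u_def[symmetric] using assms(1) u by (auto simp: orthonormal_def)
  show "inverse (norm z) *\<^sub>R z \<notin> B"
    unfolding u_def[symmetric]
  proof
    assume "u \<in> B"
    with eu[of u] have "u = 0" by simp
    with u show False by simp
  qed
qed

context
  fixes B :: "'a::chilbert_space set"
  assumes onb: "orthonormal_basis B"
begin

lemma onb_orthonormal: "orthonormal B"
  by (rule orthonormal_basis_imp_orthonormal[OF onb])

text \<open>Otherwise the normalization of \<open>z\<close> would enlarge the maximal orthonormal set \<open>B\<close>.\<close>

lemma onb_perp_zero:
  assumes "\<And>e. e \<in> B \<Longrightarrow> cinner e z = 0"
  shows "z = 0"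
proof (rule ccontr)
  assume "z \<noteq> 0"
  from orthonormal_insert_normalized[OF onb_orthonormal this assms] onb show False
    unfolding orthonormal_basis_def by (metis insertI1 subset_insertI)
qed

lemma onb_eqI:
  assumes "\<And>e. e \<in> B \<Longrightarrow> cinner e x = cinner e y"
  shows "x = y"
  using onb_perp_zero[of "x - y"] assms by (simp add: cinner_diff_right)

lemma onb_expansion: "((\<lambda>e. cinner e x *\<^sub>C e) has_sum x) B"
proof -
  obtain y where y: "((\<lambda>e. cinner e x *\<^sub>C e) has_sum y) B"
    using orthonormal_series_summable[OF onb_orthonormal orthonormal_Bessel_summable]
      onb_orthonormal summable_on_def by blast
  have "y = x"
    by (rule onb_eqI) (rule orthonormal_series_coeff[OF onb_orthonormal y])
  with y show ?thesis by simp
qed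

lemma onb_Parseval: "((\<lambda>e. cnj (cinner e x) * cinner e y) has_sum cinner x y) B"
proof -
  have "((\<lambda>e. cinner x (cinner e y *\<^sub>C e)) has_sum cinner x y) B"
    by (rule has_sum_bounded_linear[OF bounded_linear_cinner_right onb_expansion])
  moreover have "cinner x (cinner e y *\<^sub>C e) = cnj (cinner e x) * cinner e y" for e
    by (metis cinner_commute cinner_scaleC_right mult.commute)
  ultimately show ?thesis by simp
qed

lemma onb_Parseval_norm: "((\<lambda>e. (cmod (cinner e x))\<^sup>2) has_sum (norm x)\<^sup>2) B"
proof -
  have "Re (cnj z * z) = (cmod z)\<^sup>2" for z
    using cmod_power2[of z] by (simp add: power2_eq_square[of "Re z"] power2_eq_square[of "Im z"])
  with has_sum_Re[OF onb_Parseval[of x x]] show ?thesis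
    by (simp only: norm_sq_cinner)
qed

section \<open>Diagonal operators\<close>

definition diag_op :: "('a \<Rightarrow> complex) \<Rightarrow> 'a \<Rightarrow> 'a" where
  "diag_op f x = infsum (\<lambda>e. (f e * cinner e x) *\<^sub>C e) B"

context
  fixes f :: "'a \<Rightarrow> complex"
  assumes f: "bounded (f ` B)"
begin

lemma diag_op_has_sum: "((\<lambda>e. (f e * cinner e x) *\<^sub>C e) has_sum diag_op f x) B"
proof -
  obtain K where K: "\<And>e. e \<in> B \<Longrightarrow> cmod (f e) \<le> K"
    using f by (auto simp: bounded_iff)
  have "(\<lambda>e. (cmod (f e * cinner e x))\<^sup>2) summable_on B"
  proof (rule summable_on_comparison_test)
    show "(\<lambda>e. K\<^sup>2 * (cmod (cinner e x))\<^sup>2) summable_on B"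
      by (intro summable_on_cmult_right orthonormal_Bessel_summable onb_orthonormal)
    show "(cmod (f e * cinner e x))\<^sup>2 \<le> K\<^sup>2 * (cmod (cinner e x))\<^sup>2" if "e \<in> B" for e
      unfolding norm_mult power_mult_distrib
      by (intro mult_right_mono power_mono K that) simp_all
  qed simp
  then have "(\<lambda>e. (f e * cinner e x) *\<^sub>C e) summable_on B"
    by (rule orthonormal_series_summable[OF onb_orthonormal])
  then show ?thesis
    unfolding diag_op_def by (rule has_sum_infsum)
qed

lemma diag_op_coeff: "e \<in> B \<Longrightarrow> cinner e (diag_op f x) = f e * cinner e x"
  by (rule orthonormal_series_coeff[OF onb_orthonormal diag_op_has_sum])

lemma diag_op_cinner:
  "((\<lambda>e. cnj (cinner e x) * (f e * cinner e y)) has_sum cinner x (diag_op f y)) B"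
  using onb_Parseval[of x "diag_op f y"]
  by (rule has_sum_cong[THEN iffD1, rotated]) (simp add: diag_op_coeff)

lemma diag_op_form:
  "((\<lambda>e. f e * complex_of_real ((cmod (cinner e x))\<^sup>2)) has_sum cinner x (diag_op f x)) B"
proof -
  have "cnj (cinner e x) * (f e * cinner e x) = f e * complex_of_real ((cmod (cinner e x))\<^sup>2)" for e
    by (simp only: complex_norm_square mult_ac)
  with diag_op_cinner[of x x] show ?thesis by simp
qed

lemma diag_op_basis: "e \<in> B \<Longrightarrow> diag_op f e = f e *\<^sub>C e"
  by (rule onb_eqI)
     (auto simp: diag_op_coeff cinner_scaleC_right orthonormal_cinner[OF onb_orthonormal])

lemma bounded_clinear_diag_op: "bounded_clinear (diag_op f)"
proof -
  obtain K where K: "\<And>e. e \<in> B \<Longrightarrow> cmod (f e) \<le> K"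
    using f by (auto simp: bounded_iff)
  have "norm (diag_op f x) \<le> norm x * \<bar>K\<bar>" for x
  proof (rule power2_le_imp_le)
    show "(norm (diag_op f x))\<^sup>2 \<le> (norm x * \<bar>K\<bar>)\<^sup>2"
      unfolding power_mult_distrib
    proof (rule has_sum_mono[OF onb_Parseval_norm has_sum_cmult_left[OF onb_Parseval_norm]])
      fix e assume "e \<in> B"
      with K[of e] have "cmod (f e) \<le> \<bar>K\<bar>" by linarith
      then have "(cmod (f e))\<^sup>2 \<le> \<bar>K\<bar>\<^sup>2" by (intro power_mono) simp_all
      then show "(cmod (cinner e (diag_op f x)))\<^sup>2 \<le> (cmod (cinner e x))\<^sup>2 * \<bar>K\<bar>\<^sup>2"
        unfolding diag_op_coeff[OF \<open>e \<in> B\<close>] norm_mult power_mult_distrib mult.commute[of "(cmod (f e))\<^sup>2"]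
        by (intro mult_left_mono) simp_all
    qed
  qed simp
  moreover have "diag_op f (x + y) = diag_op f x + diag_op f y" for x y
    by (rule onb_eqI) (simp add: diag_op_coeff cinner_simps distrib_left)
  moreover have sc: "diag_op f (c *\<^sub>C x) = c *\<^sub>C diag_op f x" for c x
    by (rule onb_eqI) (simp add: diag_op_coeff cinner_simps)
  ultimately show ?thesis
    unfolding bounded_clinear_def by (auto simp: scaleR_scaleC intro!: bounded_linear_intro)
qed

lemma cnj_bounded: "bounded ((\<lambda>e. cnj (f e)) ` B)"
  using f by (simp add: bounded_iff)

end

lemma diag_op_adjoint:
  assumes "bounded (f ` B)"
  shows "cinner (diag_op f x) y = cinner x (diag_op (\<lambda>e. cnj (f e)) y)"
proof (rule has_sum_unique)
  show "((\<lambda>e. cnj (cinner e (diag_op f x)) * cinner e y) has_sum cinner (diag_op f x) y) B"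
    by (rule onb_Parseval)
  show "((\<lambda>e. cnj (cinner e (diag_op f x)) * cinner e y) has_sum
      cinner x (diag_op (\<lambda>e. cnj (f e)) y)) B"
    using diag_op_cinner[OF cnj_bounded[OF assms], of x y]
    by (rule has_sum_cong[THEN iffD1, rotated]) (simp add: diag_op_coeff[OF assms])
qed

lemma bounded_mult_image:
  assumes "bounded (f ` B)" "bounded (g ` B)"
  shows "bounded ((\<lambda>e. f e * g e :: complex) ` B)"
proof -
  from assms obtain K L where "\<And>e. e \<in> B \<Longrightarrow> cmod (f e) \<le> K" "\<And>e. e \<in> B \<Longrightarrow> cmod (g e) \<le> L"
    by (auto simp: bounded_iff)
  then have "\<And>e. e \<in> B \<Longrightarrow> cmod (f e * g e) \<le> K * L"
    unfolding norm_mult by (intro mult_mono) (auto intro: order_trans[OF norm_ge_zero])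
  then show ?thesis by (auto simp: bounded_iff)
qed

lemma diag_op_mult:
  assumes "bounded (f ` B)" "bounded (g ` B)"
  shows "diag_op f (diag_op g x) = diag_op (\<lambda>e. f e * g e) x"
  by (rule onb_eqI) (simp add: diag_op_coeff assms bounded_mult_image)

lemma selfadjoint_diag_op:
  assumes "bounded (f ` B)" "\<And>e. e \<in> B \<Longrightarrow> f e \<in> \<real>"
  shows "selfadjoint (diag_op f)"
proof -
  have "diag_op (\<lambda>e. cnj (f e)) = diag_op f"
    unfolding diag_op_def using assms(2) by (auto intro!: ext infsum_cong simp: Reals_cnj_iff)
  then show ?thesis
    using diag_op_adjoint[OF assms(1)] bounded_clinear_diag_op[OF assms(1)]
    by (simp add: selfadjoint_def)
qed

lemma positive_diag_op:
  assumes "bounded (f ` B)" "\<And>e. e \<in> B \<Longrightarrow> f e \<in> \<real>" "\<And>e. e \<in> B \<Longrightarrow> 0 \<le> Re (f e)"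
  shows "positive_op (diag_op f)"
proof -
  have "0 \<le> Re (cinner x (diag_op f x))" for x
    by (rule has_sum_nonneg[OF has_sum_Re[OF diag_op_form[OF assms(1)]]])
       (simp add: assms del: of_real_power)
  with selfadjoint_diag_op[OF assms(1,2)] show ?thesis
    by (simp add: positive_op_def)
qed

text \<open>The adjoint multiplies the coefficients by \<open>cnj (f e)\<close>, and \<open>cnj (f e) * f e\<close> is the square of
  \<open>cmod (f e)\<close>.\<close>

lemma abs_diag_op:
  assumes "bounded (f ` B)"
  shows "abs_op (diag_op f) = diag_op (\<lambda>e. complex_of_real (cmod (f e)))"
proof (rule abs_op_eqI)
  have b: "bounded ((\<lambda>e. complex_of_real (cmod (f e))) ` B)"
    using assms by (simp add: bounded_iff)
  show "cinner (diag_op f x) y = cinner x (diag_op (\<lambda>e. cnj (f e)) y)" for x y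
    by (rule diag_op_adjoint[OF assms])
  show "positive_op (diag_op (\<lambda>e. complex_of_real (cmod (f e))))"
    by (rule positive_diag_op[OF b]) simp_all
  show "diag_op (\<lambda>e. complex_of_real (cmod (f e))) \<circ> diag_op (\<lambda>e. complex_of_real (cmod (f e)))
      = diag_op (\<lambda>e. cnj (f e)) \<circ> diag_op f"
  proof
    fix x
    have "complex_of_real (cmod z) * complex_of_real (cmod z) = cnj z * z" for z
      by (metis complex_norm_square mult.commute of_real_mult power2_eq_square)
    then show "(diag_op (\<lambda>e. complex_of_real (cmod (f e)))
        \<circ> diag_op (\<lambda>e. complex_of_real (cmod (f e)))) x = (diag_op (\<lambda>e. cnj (f e)) \<circ> diag_op f) x"
      by (simp add: diag_op_mult b assms cnj_bounded)
  qed
qed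

text \<open>A bounded operator may be applied termwise to the basis expansion of a vector, so its values on
  the basis determine it.\<close>

lemma diagonal_eq_diag_op:
  assumes S: "bounded_clinear S" and eig: "\<And>e. e \<in> B \<Longrightarrow> S e = f e *\<^sub>C e"
  shows "bounded (f ` B)" "S = diag_op f"
proof -
  obtain K where K: "\<And>x. norm (S x) \<le> norm x * K"
    using bounded_clinearD(1)[OF S] bounded_linear.bounded by blast
  have "cmod (f e) \<le> K" if "e \<in> B" for e
  proof -
    have "norm e = 1" using onb_orthonormal that by (simp add: orthonormal_def)
    with K[of e] eig[OF that] show ?thesis by (simp add: norm_scaleC)
  qed
  then show b: "bounded (f ` B)" by (auto simp: bounded_iff)
  show "S = diag_op f"
  proof
    fix x
    have "((\<lambda>e. S (cinner e x *\<^sub>C e)) has_sum S x) B"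
      by (rule has_sum_bounded_linear[OF bounded_clinearD(1)[OF S] onb_expansion])
    then have "((\<lambda>e. (f e * cinner e x) *\<^sub>C e) has_sum S x) B"
      by (rule has_sum_cong[THEN iffD1, rotated])
         (simp add: bounded_clinearD[OF S] eig scaleC_scaleC mult.commute)
    with diag_op_has_sum[OF b, of x] show "S x = diag_op f x"
      by (metis has_sum_unique)
  qed
qed

end

section \<open>The spectral theorem for positive Hilbert-Schmidt operators\<close>

lemma selfadjoint_funpow:
  assumes "selfadjoint A"
  shows "cinner ((A ^^ m) x) ((A ^^ n) y) = cinner x ((A ^^ (m + n)) y)"
proof (induction m arbitrary: n)
  case (Suc m)
  have "cinner ((A ^^ Suc m) x) ((A ^^ n) y) = cinner ((A ^^ m) x) ((A ^^ Suc n) y)"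
    by (simp add: selfadjointD[OF assms])
  then show ?case by (simp only: Suc.IH) simp
qed simp

text \<open>Self-adjointness and Cauchy-Schwarz make \<open>\<parallel>A\<^sup>n x\<parallel>\<close> log-convex in \<open>n\<close>, so the ratio of
  consecutive terms never falls below the first one.\<close>

lemma selfadjoint_norm_funpow_ge:
  assumes A: "selfadjoint A" and "0 \<le> \<delta>" and 1: "\<delta> * norm x \<le> norm (A x)"
  shows "\<delta> ^ n * norm x \<le> norm ((A ^^ n) x)"
proof -
  define a where "a n = norm ((A ^^ n) x)" for n
  have a0: "0 \<le> a n" for n by (simp add: a_def)
  have step: "\<delta> * a n \<le> a (Suc n)" for n
  proof (induction n)
    case 0
    show ?case using 1 by (simp add: a_def)
  next
    case (Suc n)
    have "complex_of_real ((a (Suc n))\<^sup>2) = cinner ((A ^^ Suc n) x) ((A ^^ Suc n) x)"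
      by (simp only: cinner_self a_def)
    also have "\<dots> = cinner ((A ^^ n) x) ((A ^^ Suc (Suc n)) x)"
      by (simp only: selfadjoint_funpow[OF A]) simp
    finally have "(a (Suc n))\<^sup>2 = cmod (cinner ((A ^^ n) x) ((A ^^ Suc (Suc n)) x))"
      by (metis abs_of_nonneg norm_of_real zero_le_power2)
    then have convex: "(a (Suc n))\<^sup>2 \<le> a n * a (Suc (Suc n))"
      unfolding a_def using Cauchy_Schwarz by metis
    show ?case
    proof (cases "a (Suc n) = 0")
      case True
      then show ?thesis by (simp add: a0)
    next
      case False
      have "a (Suc n) * (\<delta> * a (Suc n)) = \<delta> * (a (Suc n))\<^sup>2"
        by (simp add: power2_eq_square)
      also have "\<dots> \<le> \<delta> * (a n * a (Suc (Suc n)))"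
        by (intro mult_left_mono convex assms)
      also have "\<dots> = (\<delta> * a n) * a (Suc (Suc n))" by simp
      also have "\<dots> \<le> a (Suc n) * a (Suc (Suc n))"
        by (intro mult_right_mono Suc a0)
      finally show ?thesis
        by (rule mult_left_le_imp_le) (use False a0[of "Suc n"] in simp)
    qed
  qed
  have "\<delta> ^ n * a 0 \<le> a n"
  proof (induction n)
    case (Suc n)
    have "\<delta> * (\<delta> ^ n * a 0) \<le> \<delta> * a n" by (intro mult_left_mono Suc assms)
    with step[of n] show ?case by simp
  qed simp
  then show ?thesis by (simp add: a_def)
qed

text \<open>The squared distance of \<open>A\<^sup>2\<^sup>m x\<close> and \<open>A\<^sup>2\<^sup>n x\<close> is
  \<open>c(2m) - 2 c(m+n) + c(2n)\<close>, where \<open>c(j) = \<parallel>A\<^sup>j x\<parallel>\<^sup>2\<close> decreases.\<close>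

lemma selfadjoint_contraction_even_powers_converge:
  assumes A: "selfadjoint A" and contr: "\<And>x. norm (A x) \<le> norm x"
  obtains y where "(\<lambda>n. (A ^^ (2 * n)) x) \<longlonglongrightarrow> y" "A (A y) = y"
proof -
  define c where "c j = (norm ((A ^^ j) x))\<^sup>2" for j
  have c: "Re (cinner ((A ^^ i) x) ((A ^^ j) x)) = c k" if "i + j = 2 * k" for i j k
  proof -
    have "cinner ((A ^^ i) x) ((A ^^ j) x) = cinner ((A ^^ k) x) ((A ^^ k) x)"
      by (simp add: selfadjoint_funpow[OF A] that mult_2)
    then show ?thesis by (simp add: c_def norm_sq_cinner)
  qed
  have "decseq c"
    unfolding decseq_Suc_iff c_def using contr by (simp add: power_mono)
  then obtain L where "c \<longlonglongrightarrow> L"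
    by (rule decseq_convergent[of c 0]) (simp add: c_def)
  then have "Cauchy c" by (rule LIMSEQ_imp_Cauchy)
  have "Cauchy (\<lambda>n. (A ^^ (2 * n)) x)"
  proof (rule metric_CauchyI)
    fix r :: real assume "0 < r"
    then have "0 < r\<^sup>2 / 2" by simp
    then obtain N where N: "\<And>i j. N \<le> i \<Longrightarrow> N \<le> j \<Longrightarrow> dist (c i) (c j) < r\<^sup>2 / 2"
      using \<open>Cauchy c\<close> metric_CauchyD by meson
    have "dist ((A ^^ (2 * m)) x) ((A ^^ (2 * n)) x) < r" if "N \<le> m" "N \<le> n" for m n
    proof (rule power2_less_imp_less)
      have "(dist ((A ^^ (2 * m)) x) ((A ^^ (2 * n)) x))\<^sup>2
          = c (2 * m) - 2 * c (m + n) + c (2 * n)"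
        by (simp add: dist_norm norm_diff_sq c[of "2 * m" "2 * n" "m + n"])
           (simp add: c_def)
      also have "\<dots> < r\<^sup>2"
        using N[of "2 * m" "m + n"] N[of "2 * n" "m + n"] that
        by (simp add: dist_real_def abs_if split: if_splits)
      finally show "(dist ((A ^^ (2 * m)) x) ((A ^^ (2 * n)) x))\<^sup>2 < r\<^sup>2" .
    qed (use \<open>0 < r\<close> in simp)
    then show "\<exists>M. \<forall>m\<ge>M. \<forall>n\<ge>M. dist ((A ^^ (2 * m)) x) ((A ^^ (2 * n)) x) < r"
      by blast
  qed
  then obtain y where y: "(\<lambda>n. (A ^^ (2 * n)) x) \<longlonglongrightarrow> y"
    using Cauchy_convergent convergent_def by blast
  have bl: "bounded_linear A" by (rule bounded_clinearD[OF selfadjointD(1)[OF A]])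
  have "(\<lambda>n. A (A ((A ^^ (2 * n)) x))) \<longlonglongrightarrow> A (A y)"
    by (intro bounded_linear.tendsto[OF bl] y)
  moreover have "(\<lambda>n. A (A ((A ^^ (2 * n)) x))) \<longlonglongrightarrow> y"
    using LIMSEQ_Suc[OF y] by simp
  ultimately have "A (A y) = y" by (rule LIMSEQ_unique)
  with y that show ?thesis by blast
qed

text \<open>A quantitative dominated convergence: outside the finite set \<open>F\<close> the terms \<open>h\<close> are replaced by
  their majorants \<open>g\<close>.\<close>

lemma summable_tail_bound:
  fixes g h :: "'a \<Rightarrow> real"
  assumes g: "(g has_sum L) B" and F: "finite F" "F \<subseteq> B"
    and h: "(h has_sum H) B" and le: "\<And>e. e \<in> B \<Longrightarrow> h e \<le> g e"
  shows "H \<le> (L - sum g F) + sum h F"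
proof -
  have "((\<lambda>e. if e \<in> F then h e - g e else 0) has_sum (sum h F - sum g F)) B"
    by (rule has_sum_finite_neutralI[of F]) (use F in \<open>auto simp: sum_subtractf\<close>)
  from has_sum_add[OF g this]
  have "((\<lambda>e. g e + (if e \<in> F then h e - g e else 0)) has_sum (L + (sum h F - sum g F))) B" .
  then have "H \<le> L + (sum h F - sum g F)"
    by (rule has_sum_mono[OF h]) (use le in auto)
  then show ?thesis by simp
qed

text \<open>Normalise to \<open>\<parallel>A\<parallel> = 1\<close>. Every limit of \<open>A\<^sup>2\<^sup>n x\<close> is fixed by \<open>A\<^sup>2\<close>, and a nonzero one gives an
  eigenvector of \<open>A\<close>. If all these limits vanished, dominated convergence over the basis would
  make the Hilbert-Schmidt norm of \<open>A\<^sup>2\<^sup>n\<close>, and with it the operator norm, tend to \<open>0\<close>; but a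
  self-adjoint operator of norm \<open>1\<close> has powers of norm \<open>1\<close>.\<close>

lemma positive_Hilbert_Schmidt_eigenvector:
  assumes B: "orthonormal_basis B" and R: "positive_op R"
    and HS: "(\<lambda>e. (norm (R e))\<^sup>2) summable_on B" and nz: "R x0 \<noteq> 0"
  obtains v r where "v \<noteq> 0" "r \<noteq> 0" "R v = complex_of_real r *\<^sub>C v"
proof -
  define k where "k = onorm R"
  have bl: "bounded_linear R" by (rule bounded_clinearD[OF positive_opD(2)[OF R]])
  have k: "0 < k" unfolding k_def using nz onorm_pos_lt[OF bl] by blast
  define A where "A = (\<lambda>x. complex_of_real (1 / k) *\<^sub>C R x)"
  have normA: "norm (A x) = norm (R x) / k" for x
    using k by (simp add: A_def norm_scaleC norm_divide)
  have Apos: "positive_op A"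
    unfolding A_def using k by (intro positive_op_scaleC R) simp
  note As = positive_opD(1)[OF Apos] and Ac = bounded_clinearD[OF positive_opD(2)[OF Apos]]
  have RA: "R x = complex_of_real k *\<^sub>C A x" for x
    using k by (simp add: A_def scaleC_scaleC)
  have contr: "norm (A x) \<le> norm x" for x
    using onorm[OF bl, of x] k by (simp add: normA k_def[symmetric] field_simps)
  have contr_pow: "norm ((A ^^ n) x) \<le> norm x" for n x
    by (induction n) (auto intro: order_trans[OF contr])
  have "\<exists>x y. (\<lambda>n. (A ^^ (2 * n)) x) \<longlonglongrightarrow> y \<and> A (A y) = y \<and> y \<noteq> 0"
  proof (rule ccontr)
    assume none: "\<not> ?thesis"
    have lim0: "(\<lambda>n. (A ^^ (2 * n)) x) \<longlonglongrightarrow> 0" for x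
      using selfadjoint_contraction_even_powers_converge[OF As contr, of x] none by metis
    have "(\<lambda>e. (1 / k)\<^sup>2 * (norm (R e))\<^sup>2) summable_on B"
      by (intro summable_on_cmult_right HS)
    then obtain L where L: "((\<lambda>e. (norm (A e))\<^sup>2) has_sum L) B"
      by (auto simp: normA power_divide summable_on_def)
    \<comment> \<open>The tail outside \<open>F\<close> and the finite part over \<open>F\<close> each contribute at most \<open>1/4\<close> to \<open>\<Sum>\<parallel>P e\<parallel>\<^sup>2\<close>, where
      \<open>P = A\<^sup>2\<^sup>n\<close>; the exponent must be positive for \<open>\<parallel>P e\<parallel> \<le> \<parallel>A e\<parallel>\<close>.\<close>
    obtain F where F: "finite F" "F \<subseteq> B" "dist (\<Sum>e\<in>F. (norm (A e))\<^sup>2) L \<le> 1 / 4"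
      using has_sum_finite_approximation[OF L, of "1 / 4"] by auto
    have "(\<lambda>n. \<Sum>e\<in>F. (norm ((A ^^ (2 * n)) e))\<^sup>2) \<longlonglongrightarrow> (\<Sum>e\<in>F. (norm (0::'a))\<^sup>2)"
      by (intro tendsto_intros lim0)
    then have "(\<lambda>n. \<Sum>e\<in>F. (norm ((A ^^ (2 * n)) e))\<^sup>2) \<longlonglongrightarrow> 0" by simp
    then have "\<forall>\<^sub>F n in sequentially. (\<Sum>e\<in>F. (norm ((A ^^ (2 * n)) e))\<^sup>2) < 1 / 4"
      by (rule order_tendstoD) simp
    then obtain n where n: "0 < n" "(\<Sum>e\<in>F. (norm ((A ^^ (2 * n)) e))\<^sup>2) < 1 / 4"
      unfolding eventually_sequentially by (metis le_add2 zero_less_Suc add_Suc_right le_Suc_eq nat_le_linear)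
    define P where "P = A ^^ (2 * n)"
    have P_le: "(norm (P e))\<^sup>2 \<le> (norm (A e))\<^sup>2" for e
    proof (intro power_mono)
      have "P e = (A ^^ (2 * n - 1)) (A e)"
        unfolding P_def using n by (metis Suc_diff_1 comp_apply funpow_Suc_right nat_0_less_mult_iff pos2)
      then show "norm (P e) \<le> norm (A e)" by (simp add: contr_pow)
    qed simp
    obtain H where H: "((\<lambda>e. (norm (P e))\<^sup>2) has_sum H) B"
      using summable_on_comparison_test[of "\<lambda>e. (norm (A e))\<^sup>2" B "\<lambda>e. (norm (P e))\<^sup>2"] L P_le
      by (auto simp: summable_on_def)
    have "H \<le> (L - (\<Sum>e\<in>F. (norm (A e))\<^sup>2)) + (\<Sum>e\<in>F. (norm (P e))\<^sup>2)"
      by (rule summable_tail_bound[OF L F(1,2) H P_le])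
    then have H_le: "H \<le> 1 / 2"
      using F(3) n(2) unfolding P_def dist_real_def by linarith
    have P_norm: "(norm (P x))\<^sup>2 \<le> 1 / 2 * (norm x)\<^sup>2" for x
    proof -
      have "(norm (P x))\<^sup>2 \<le> H * (norm x)\<^sup>2"
      proof (rule has_sum_mono[OF onb_Parseval_norm[OF B] has_sum_cmult_left[OF H]])
        fix e assume "e \<in> B"
        have "cinner e (P x) = cinner (P e) x"
          using selfadjoint_funpow[OF As, of "2 * n" e 0 x] by (simp add: P_def)
        then have "cmod (cinner e (P x)) \<le> norm (P e) * norm x"
          by (simp add: Cauchy_Schwarz)
        then show "(cmod (cinner e (P x)))\<^sup>2 \<le> (norm (P e))\<^sup>2 * (norm x)\<^sup>2"
          unfolding power_mult_distrib[symmetric] by (intro power_mono) simp_all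
      qed
      also have "\<dots> \<le> 1 / 2 * (norm x)\<^sup>2"
        by (intro mult_right_mono H_le) simp
      finally show ?thesis .
    qed
    \<comment> \<open>A vector on which \<open>A\<close> nearly attains its norm has \<open>\<parallel>P x\<parallel>\<^sup>2 \<ge> \<delta>\<^sup>4\<^sup>n \<parallel>x\<parallel>\<^sup>2 = 3/4 \<parallel>x\<parallel>\<^sup>2\<close>, against the bound
      \<open>1/2 \<parallel>x\<parallel>\<^sup>2\<close> just obtained.\<close>
    define \<delta> where "\<delta> = root (4 * n) (3 / 4)"
    have \<delta>: "0 \<le> \<delta>" "\<delta> < 1" "\<delta> ^ (4 * n) = 3 / 4"
      using n by (simp_all add: \<delta>_def real_root_lt_1_iff)
    obtain x where x: "\<delta> * norm x < norm (A x)"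
    proof (rule ccontr)
      assume *: "\<not> thesis"
      have "norm (R x) \<le> (\<delta> * k) * norm x" for x
        using that[of x] * k by (force simp: normA field_simps not_less)
      then have "onorm R \<le> \<delta> * k"
        using k \<delta> by (intro onorm_bound) simp_all
      with k \<delta> show False by (simp add: k_def[symmetric])
    qed
    have "(\<delta> ^ (2 * n) * norm x)\<^sup>2 \<le> (norm (P x))\<^sup>2"
      unfolding P_def
      by (intro power_mono selfadjoint_norm_funpow_ge[OF As \<delta>(1)]) (use x \<delta> in auto)
    moreover have "(\<delta> ^ (2 * n) * norm x)\<^sup>2 = 3 / 4 * (norm x)\<^sup>2"
      using \<delta>(3) by (simp add: power_mult_distrib power_mult[symmetric] mult.commute)
    ultimately have "3 / 4 * (norm x)\<^sup>2 \<le> 1 / 2 * (norm x)\<^sup>2"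
      using P_norm[of x] by linarith
    then have "x = 0" by simp
    with x show False by (simp add: Ac)
  qed
  then obtain y where y: "A (A y) = y" "y \<noteq> 0" by blast
  \<comment> \<open>\<open>v\<close> is fixed by \<open>A\<close>; it vanishes only if \<open>-1\<close> is an eigenvalue, which positivity excludes.\<close>
  define v where "v = y + A y"
  have "v \<noteq> 0"
  proof
    assume "v = 0"
    then have "A y = - y" by (simp add: v_def minus_unique)
    then have "0 \<le> - (norm y)\<^sup>2"
      using positive_opD(4)[OF Apos, of y] by (simp add: cinner_minus_right norm_sq_cinner)
    with y(2) show False by simp
  qed
  moreover have "R v = complex_of_real k *\<^sub>C v"
    by (simp add: RA v_def Ac y add.commute)
  ultimately show ?thesis using k that[of v k] by simp
qed

lemma orthonormal_Union_chain:
  assumes "subset.chain \<A> \<C>" and "\<And>B. B \<in> \<C> \<Longrightarrow> orthonormal B"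
  shows "orthonormal (\<Union>\<C>)"
proof -
  have "cinner e e' = 0" if "e \<in> \<Union>\<C>" "e' \<in> \<Union>\<C>" "e \<noteq> e'" for e e'
  proof -
    from that obtain X Y where XY: "X \<in> \<C>" "e \<in> X" "Y \<in> \<C>" "e' \<in> Y" by blast
    with assms(1) have "X \<subseteq> Y \<or> Y \<subseteq> X"
      by (auto simp: subset_chain_def)
    with XY obtain B where "B \<in> \<C>" "e \<in> B" "e' \<in> B" by blast
    with assms(2)[of B] that(3) show ?thesis by (auto simp: orthonormal_def)
  qed
  with assms(2) show ?thesis by (auto simp: orthonormal_def)
qed

lemma orthonormal_extends_to_basis:
  assumes "orthonormal M"
  obtains B where "orthonormal_basis B" "M \<subseteq> B"
proof -
  define \<A> where "\<A> = {B. orthonormal B \<and> M \<subseteq> B}"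
  have "\<exists>B\<in>\<A>. \<forall>X\<in>\<A>. B \<subseteq> X \<longrightarrow> X = B"
  proof (rule subset_Zorn_nonempty)
    show "\<A> \<noteq> {}" using assms by (auto simp: \<A>_def)
    fix \<C> assume "\<C> \<noteq> {}" and ch: "subset.chain \<A> \<C>"
    moreover from ch have "\<C> \<subseteq> \<A>" by (simp add: subset.chain_def)
    ultimately show "\<Union>\<C> \<in> \<A>"
      using orthonormal_Union_chain[OF ch] by (auto simp: \<A>_def)
  qed
  then obtain B where B: "B \<in> \<A>" and max: "\<forall>X\<in>\<A>. B \<subseteq> X \<longrightarrow> X = B" ..
  have "orthonormal_basis B"
    unfolding orthonormal_basis_def
  proof (intro conjI allI impI)
    show "orthonormal B" using B by (simp add: \<A>_def)
    fix B' assume B': "orthonormal B' \<and> B \<subseteq> B'"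
    with B have "B' \<in> \<A>" by (auto simp: \<A>_def)
    with max B' show "B' = B" by simp
  qed
  moreover have "M \<subseteq> B" using B by (simp add: \<A>_def)
  ultimately show ?thesis by (rule that)
qed

text \<open>A maximal orthonormal set \<open>M\<close> of eigenvectors is a basis: otherwise, for the projection \<open>P\<close>
  onto its orthogonal complement, which commutes with \<open>T\<close>, the compression \<open>P T\<close> either vanishes
  or has an eigenvector, and both cases give a further eigenvector orthogonal to \<open>M\<close>.\<close>

theorem positive_Hilbert_Schmidt_eigenbasis:
  assumes B0: "orthonormal_basis B0" and T: "positive_op T"
    and HS: "(\<lambda>e. (norm (T e))\<^sup>2) summable_on B0"
  obtains B \<mu> where "orthonormal_basis B" "\<And>e. e \<in> B \<Longrightarrow> T e = complex_of_real (\<mu> e) *\<^sub>C e"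
proof -
  note Tp = positive_opD[OF T]
  note Tl = bounded_clinearD[OF Tp(2)]
  define \<A> where "\<A> = {M. orthonormal M \<and> (\<forall>e\<in>M. \<exists>r::real. T e = complex_of_real r *\<^sub>C e)}"
  have "\<exists>M\<in>\<A>. \<forall>X\<in>\<A>. M \<subseteq> X \<longrightarrow> X = M"
  proof (rule subset_Zorn_nonempty)
    show "\<A> \<noteq> {}" by (auto simp: \<A>_def orthonormal_def intro!: exI[of _ "{}"])
    fix \<C> assume "\<C> \<noteq> {}" and ch: "subset.chain \<A> \<C>"
    moreover from ch have "\<C> \<subseteq> \<A>" by (simp add: subset.chain_def)
    ultimately show "\<Union>\<C> \<in> \<A>"
      using orthonormal_Union_chain[OF ch] by (auto simp: \<A>_def)
  qed
  then obtain M where MA: "M \<in> \<A>" and max: "\<forall>X\<in>\<A>. M \<subseteq> X \<longrightarrow> X = M" ..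
  from MA have M: "orthonormal M" "\<And>e. e \<in> M \<Longrightarrow> \<exists>r::real. T e = complex_of_real r *\<^sub>C e"
    by (simp_all add: \<A>_def)
  have no_eig: False if "v \<noteq> 0" "T v = complex_of_real r *\<^sub>C v" "\<And>e. e \<in> M \<Longrightarrow> cinner e v = 0" for v r
  proof -
    let ?u = "inverse (norm v) *\<^sub>R v"
    have "T ?u = complex_of_real r *\<^sub>C ?u"
      by (simp add: Tl that(2) scaleR_scaleC scaleC_scaleC mult.commute)
    with M orthonormal_insert_normalized(1)[OF M(1) that(1,3)] have "insert ?u M \<in> \<A>"
      unfolding \<A>_def by blast
    with max have "insert ?u M = M" by blast
    with orthonormal_insert_normalized(2)[OF M(1) that(1,3)] show False
      by blast
  qed
  obtain B where B: "orthonormal_basis B" "M \<subseteq> B"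
    using orthonormal_extends_to_basis[OF M(1)] .
  have "B = M"
  proof (rule ccontr)
    assume "B \<noteq> M"
    then obtain z where z: "z \<in> B" "z \<notin> M" using B by blast
    note on = orthonormal_basis_imp_orthonormal[OF B(1)]
    define p :: "'a \<Rightarrow> complex" where "p e = (if e \<in> M then 0 else 1)" for e
    define P where "P = diag_op B p"
    have p: "bounded (p ` B)"
      by (rule boundedI[of _ 1]) (auto simp: p_def)
    have Pco: "cinner e (P x) = p e * cinner e x" if "e \<in> B" for e x
      unfolding P_def by (rule diag_op_coeff[OF B(1) p that])
    have Psa: "selfadjoint P"
      unfolding P_def by (rule selfadjoint_diag_op[OF B(1) p]) (simp add: p_def)
    note Pl = bounded_clinearD[OF selfadjointD(1)[OF Psa]]
    have PP: "P (P x) = P x" for x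
      by (rule onb_eqI[OF B(1)]) (simp add: Pco p_def)
    have Pfix: "P x = x" if "\<And>e. e \<in> M \<Longrightarrow> cinner e x = 0" for x
      by (rule onb_eqI[OF B(1)]) (simp add: Pco p_def that)
    \<comment> \<open>The orthogonal complement of \<open>M\<close> is invariant under \<open>T\<close>.\<close>
    have eT: "cinner e (T x) = 0" if e: "e \<in> M" and "cinner e x = 0" for e x
    proof -
      obtain r :: real where "T e = complex_of_real r *\<^sub>C e" using M(2)[OF e] by blast
      with that show ?thesis by (simp add: Tp(3)[symmetric] cinner_scaleC_left)
    qed
    have comm: "T (P x) = P (T x)" for x
    proof (rule onb_eqI[OF B(1)])
      fix e assume e: "e \<in> B"
      show "cinner e (T (P x)) = cinner e (P (T x))"
      proof (cases "e \<in> M")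
        case True
        then show ?thesis using e by (simp add: Pco p_def eT)
      next
        case False
        have "P (T e) = T e"
        proof (rule Pfix)
          fix e' assume e': "e' \<in> M"
          with False B(2) e have "cinner e' e = 0"
            by (auto simp: orthonormal_cinner[OF on])
          with e' show "cinner e' (T e) = 0" by (rule eT)
        qed
        have "cinner e (T (P x)) = cinner (T e) (P x)" by (simp add: Tp(3))
        also have "\<dots> = cinner (P (T e)) x" by (simp add: selfadjointD(2)[OF Psa])
        also have "\<dots> = cinner e (T x)" by (simp add: \<open>P (T e) = T e\<close> Tp(3))
        also have "\<dots> = cinner e (P (T x))" using False by (simp add: Pco[OF e] p_def)
        finally show ?thesis .
      qed
    qed
    define R where "R = (\<lambda>x. P (T x))"
    have R: "positive_op R"
      unfolding positive_op_def selfadjoint_def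
    proof (intro conjI allI)
      show "bounded_clinear R"
        unfolding R_def by (rule bounded_clinear_compose[OF selfadjointD(1)[OF Psa] Tp(2)])
      show "cinner (R x) y = cinner x (R y)" for x y
        by (simp add: R_def selfadjointD(2)[OF Psa] Tp(3) comm)
      have "cinner x (R x) = cinner (P x) (T (P x))" for x
        unfolding R_def by (simp only: comm selfadjointD(2)[OF Psa] PP)
      then show "0 \<le> Re (cinner x (R x))" for x
        using Tp(4)[of "P x"] by simp
    qed
    have P_le: "norm (P x) \<le> norm x" for x
    proof -
      have "(norm (P x))\<^sup>2 = Re (cinner x (P x))"
        by (simp add: norm_sq_cinner selfadjointD(2)[OF Psa] PP)
      also have "\<dots> \<le> norm x * norm (P x)"
        using Cauchy_Schwarz complex_Re_le_cmod order_trans by blast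
      finally have "norm (P x) * norm (P x) \<le> norm x * norm (P x)"
        by (simp add: power2_eq_square)
      then show ?thesis
        by (cases "P x = 0") simp_all
    qed
    show False
    proof (cases "\<forall>x. R x = 0")
      case True
      have zM: "cinner e z = 0" if "e \<in> M" for e
        using that z B(2) by (auto simp: orthonormal_cinner[OF on])
      have "T z = R z" using comm[of z] Pfix[of z] zM by (simp add: R_def)
      with True have "T z = complex_of_real 0 *\<^sub>C z" by simp
      moreover have "z \<noteq> 0" using on z(1) by (auto simp: orthonormal_def)
      ultimately show False using no_eig[of z 0] zM by blast
    next
      case False
      then obtain x0 where "R x0 \<noteq> 0" by blast
      moreover have "(\<lambda>e. (norm (R e))\<^sup>2) summable_on B0"
        by (rule summable_on_comparison_test[OF HS]) (simp_all add: R_def P_le power_mono)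
      ultimately obtain v r where v: "v \<noteq> 0" "r \<noteq> 0" "R v = complex_of_real r *\<^sub>C v"
        using positive_Hilbert_Schmidt_eigenvector[OF B0 R] by metis
      have "complex_of_real r *\<^sub>C P v = P (R v)" by (simp add: v(3) Pl)
      also have "\<dots> = complex_of_real r *\<^sub>C v" by (simp add: R_def PP flip: v(3))
      finally have "(1 / complex_of_real r) *\<^sub>C complex_of_real r *\<^sub>C P v
          = (1 / complex_of_real r) *\<^sub>C complex_of_real r *\<^sub>C v" by simp
      then have Pv: "P v = v" using v(2) by (simp add: scaleC_scaleC)
      then have "T v = complex_of_real r *\<^sub>C v"
        using comm[of v] v(3) by (simp add: R_def)
      moreover have "cinner e v = 0" if "e \<in> M" for e
        using Pco[of e v] that B(2) by (auto simp: Pv p_def)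
      ultimately show False using no_eig v(1) by blast
    qed
  qed
  moreover obtain \<mu> where "\<And>e. e \<in> M \<Longrightarrow> T e = complex_of_real (\<mu> e) *\<^sub>C e"
    using M(2) by metis
  ultimately show ?thesis using that B(1) by blast
qed

section \<open>Traces of diagonal operators\<close>

lemma cmod_cinner_commute: "cmod (cinner x y) = cmod (cinner y x)"
  by (metis cinner_commute complex_mod_cnj)

lemma onb_Parseval_basis:
  assumes "orthonormal_basis B'" "orthonormal B" "b \<in> B"
  shows "((\<lambda>e. (cmod (cinner b e))\<^sup>2) has_sum 1) B'"
  using onb_Parseval_norm[OF assms(1), of b] assms(2,3)
  by (simp add: orthonormal_def cmod_cinner_commute[of b])

text \<open>Summed over both bases, \<open>f(b) \<bar>\<langle>b, e\<rangle>\<bar>\<^sup>2\<close> gives the trace in the basis of the \<open>e\<close> when the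
  sum over \<open>b\<close> is carried out first, and \<open>\<Sum>f(b)\<close> when the sum over \<open>e\<close> is.\<close>

lemma diag_op_trace:
  assumes B: "orthonormal_basis B" and B': "orthonormal_basis B'"
    and bd: "bounded (f ` B)" and f: "(f has_sum s) B" and abs: "(\<lambda>e. cmod (f e)) summable_on B"
  shows "((\<lambda>e. cinner e (diag_op B f e)) has_sum s) B'"
proof -
  define G where "G = (\<lambda>(b, e). f b * complex_of_real ((cmod (cinner b e))\<^sup>2))"
  note on = orthonormal_basis_imp_orthonormal[OF B]
  have "(\<lambda>p. norm (G p)) summable_on B \<times> B'"
  proof (rule summable_on_SigmaI[OF _ abs])
    fix b assume "b \<in> B"
    from has_sum_cmult_right[OF onb_Parseval_basis[OF B' on this], of "cmod (f b)"]
    show "((\<lambda>e. norm (G (b, e))) has_sum cmod (f b)) B'"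
      by (simp add: G_def norm_mult norm_power)
  qed simp
  then have "G summable_on B \<times> B'" by (rule abs_summable_summable)
  then obtain t where t: "(G has_sum t) (B \<times> B')" by (auto simp: summable_on_def)
  have "(f has_sum t) B"
  proof (rule has_sum_SigmaD[OF t])
    fix b assume "b \<in> B"
    from has_sum_cmult_right[OF has_sum_of_real[OF onb_Parseval_basis[OF B' on this]], of "f b"]
    show "((\<lambda>e. G (b, e)) has_sum f b) B'"
      by (simp add: G_def)
  qed
  with f have "t = s" by (metis has_sum_unique)
  from t have "((\<lambda>(e, b). G (b, e)) has_sum t) (B' \<times> B)"
    by (simp add: has_sum_swap[of G])
  then have "((\<lambda>e. cinner e (diag_op B f e)) has_sum t) B'"
  proof (rule has_sum_SigmaD)
    fix e assume "e \<in> B'"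
    show "((\<lambda>b. (\<lambda>(e, b). G (b, e)) (e, b)) has_sum cinner e (diag_op B f e)) B"
      using diag_op_form[OF B bd, of e] by (simp add: G_def)
  qed
  with \<open>t = s\<close> show ?thesis by simp
qed

lemma op_trace_diag_op:
  assumes "orthonormal_basis B" "bounded (f ` B)" "(f has_sum s) B" "(\<lambda>e. cmod (f e)) summable_on B"
  shows "op_trace (diag_op B f) = s"
  unfolding op_trace_def
proof (rule the_equality)
  show "\<forall>B'. orthonormal_basis B' \<longrightarrow> ((\<lambda>e. cinner e (diag_op B f e)) has_sum s) B'"
    using diag_op_trace assms by blast
  then show "z = s" if "\<forall>B'. orthonormal_basis B' \<longrightarrow> ((\<lambda>e. cinner e (diag_op B f e)) has_sum z) B'" for z
    using that assms(1) has_sum_unique by blast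
qed

lemma trace_class_diag_op:
  assumes B: "orthonormal_basis B" and bd: "bounded (f ` B)" and abs: "(\<lambda>e. cmod (f e)) summable_on B"
  shows "trace_class (diag_op B f)"
proof -
  let ?g = "\<lambda>e. complex_of_real (cmod (f e))"
  have "?g summable_on B" by (rule summable_on_of_real[OF abs])
  moreover have "cinner e (diag_op B ?g e) = ?g e" if "e \<in> B" for e
    using that bd orthonormal_basis_imp_orthonormal[OF B]
    by (simp add: diag_op_coeff[OF B] bounded_iff orthonormal_cinner)
  ultimately have "(\<lambda>e. cinner e (abs_op (diag_op B f) e)) summable_on B"
    unfolding abs_diag_op[OF B bd] by (simp cong: summable_on_cong)
  with B bounded_clinear_diag_op[OF B bd] show ?thesis
    unfolding trace_class_def by blast
qed

text \<open>The same double sum with nonnegative terms, where finiteness of the iterated sum in one order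
  gives finiteness in the other.\<close>

lemma diag_op_nonneg_trace_summable:
  assumes B: "orthonormal_basis B" and B': "orthonormal_basis B'"
    and bd: "bounded ((\<lambda>e. complex_of_real (r e)) ` B)" and r: "\<And>e. e \<in> B \<Longrightarrow> 0 \<le> r e"
    and tr: "(\<lambda>e. Re (cinner e (diag_op B (\<lambda>e. complex_of_real (r e)) e))) summable_on B'"
  shows "r summable_on B"
proof -
  define G where "G = (\<lambda>(e, b). r b * (cmod (cinner b e))\<^sup>2)"
  have "G summable_on B' \<times> B"
  proof (rule summable_on_SigmaI[OF _ tr])
    fix e
    have "Re (complex_of_real (r b) * complex_of_real ((cmod (cinner b e))\<^sup>2)) = G (e, b)" for b
      by (simp add: G_def del: of_real_power)
    then show "((\<lambda>b. G (e, b)) has_sum Re (cinner e (diag_op B (\<lambda>e. complex_of_real (r e)) e))) B"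
      using has_sum_Re[OF diag_op_form[OF B bd, of e]] by simp
  qed (auto simp: G_def r)
  then obtain t where "(G has_sum t) (B' \<times> B)" by (auto simp: summable_on_def)
  then have "((\<lambda>(b, e). G (e, b)) has_sum t) (B \<times> B')"
    by (simp add: has_sum_swap[of G])
  then have "(r has_sum t) B"
  proof (rule has_sum_SigmaD)
    fix b assume "b \<in> B"
    from has_sum_cmult_right[OF onb_Parseval_basis[OF B' orthonormal_basis_imp_orthonormal[OF B] this],
        of "r b"]
    show "((\<lambda>e. (\<lambda>(b, e). G (e, b)) (b, e)) has_sum r b) B'"
      by (simp add: G_def)
  qed
  then show ?thesis by (auto simp: summable_on_def)
qed

text \<open>A positive trace-class operator is Hilbert-Schmidt because \<open>T\<^sup>2 \<le> \<parallel>T\<parallel> T\<close>.\<close>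

lemma positive_trace_class_diagonal:
  assumes T: "positive_op T" and tc: "trace_class T"
  obtains B r where "orthonormal_basis B" "T = diag_op B (\<lambda>e. complex_of_real (r e))"
    "bounded ((\<lambda>e. complex_of_real (r e)) ` B)" "\<And>e. e \<in> B \<Longrightarrow> T e = complex_of_real (r e) *\<^sub>C e"
    "\<And>e. e \<in> B \<Longrightarrow> 0 \<le> r e" "r summable_on B"
proof -
  from tc obtain B0 where B0: "orthonormal_basis B0" and "(\<lambda>e. cinner e (T e)) summable_on B0"
    by (auto simp: trace_class_def abs_op_positive[OF T])
  then have tr: "(\<lambda>e. Re (cinner e (T e))) summable_on B0" by (intro summable_on_Re)
  note Tp = positive_opD[OF T]
  obtain K where K: "\<And>x. norm (T x) \<le> K * norm x"
    using bounded_linear.bounded[OF bounded_clinearD(1)[OF Tp(2)]] by (metis mult.commute)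
  have "(\<lambda>e. (norm (T e))\<^sup>2) summable_on B0"
    by (rule summable_on_comparison_test[OF summable_on_cmult_right[OF tr, of K]])
       (simp_all add: positive_op_norm_sq_le[OF T K])
  then obtain B r where B: "orthonormal_basis B"
    and eig: "\<And>e. e \<in> B \<Longrightarrow> T e = complex_of_real (r e) *\<^sub>C e"
    using positive_Hilbert_Schmidt_eigenbasis[OF B0 T] by metis
  note d = diagonal_eq_diag_op[OF B Tp(2), of "\<lambda>e. complex_of_real (r e)", OF eig]
  have pos: "0 \<le> r e" if "e \<in> B" for e
    using Tp(4)[of e] that orthonormal_basis_imp_orthonormal[OF B]
    by (simp add: eig cinner_scaleC_right orthonormal_cinner)
  have "r summable_on B"
    by (rule diag_op_nonneg_trace_summable[OF B B0 d(1) pos]) (use tr d(2) in simp_all)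
  with B d eig pos that show ?thesis by blast
qed

section \<open>The spectral measure of a diagonal operator\<close>

lemma eigenvalue_in_spectrum:
  assumes T: "bounded_clinear T" and "T e = z *\<^sub>C e" "e \<noteq> 0"
  shows "z \<in> spectrum T"
  unfolding spectrum_def
proof (intro CollectI notI, elim exE conjE)
  fix S assume S: "bounded_clinear S" and inv: "\<forall>x. S (T x - z *\<^sub>C x) = x"
  from inv have "S (T e - z *\<^sub>C e) = e" by blast
  with assms(2,3) show False by (simp add: bounded_clinearD[OF S])
qed

text \<open>The resolvent is the diagonal operator with entries \<open>1 / (f(e) - z)\<close>, which are bounded by
  \<open>1 / d\<close>.\<close>

lemma not_in_spectrum_diag_op:
  assumes B: "orthonormal_basis B" and bd: "bounded (f ` B)"
    and d: "0 < d" "\<And>e. e \<in> B \<Longrightarrow> d \<le> cmod (f e - z)"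
  shows "z \<notin> spectrum (diag_op B f)"
proof -
  define g where "g e = 1 / (f e - z)" for e
  have g: "bounded (g ` B)"
  proof (rule boundedI)
    fix y assume "y \<in> g ` B"
    then obtain e where e: "e \<in> B" "y = g e" by blast
    then show "norm y \<le> 1 / d"
      using d(1) d(2)[of e] by (simp add: g_def norm_divide frac_le)
  qed
  have inv: "g e * (f e - z) = 1" if "e \<in> B" for e
    using d(1) d(2)[OF that] by (auto simp: g_def)
  have "diag_op B g (diag_op B f x - z *\<^sub>C x) = x" for x
  proof (rule onb_eqI[OF B])
    fix e assume e: "e \<in> B"
    have "cinner e (diag_op B g (diag_op B f x - z *\<^sub>C x)) = g e * (f e - z) * cinner e x"
      by (simp add: diag_op_coeff[OF B g e] diag_op_coeff[OF B bd e] cinner_simps algebra_simps)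
    then show "cinner e (diag_op B g (diag_op B f x - z *\<^sub>C x)) = cinner e x"
      by (simp add: inv[OF e])
  qed
  moreover have "diag_op B f (diag_op B g x) - z *\<^sub>C diag_op B g x = x" for x
  proof (rule onb_eqI[OF B])
    fix e assume e: "e \<in> B"
    have "cinner e (diag_op B f (diag_op B g x) - z *\<^sub>C diag_op B g x) = g e * (f e - z) * cinner e x"
      by (simp add: diag_op_coeff[OF B g e] diag_op_coeff[OF B bd e] cinner_simps algebra_simps)
    then show "cinner e (diag_op B f (diag_op B g x) - z *\<^sub>C diag_op B g x) = cinner e x"
      by (simp add: inv[OF e])
  qed
  ultimately show ?thesis
    using bounded_clinear_diag_op[OF B g] unfolding spectrum_def by blast
qed

definition diag_spectral_measure :: "'a::chilbert_space set \<Rightarrow> ('a \<Rightarrow> 'b) \<Rightarrow> 'b set \<Rightarrow> 'a \<Rightarrow> 'a" where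
  "diag_spectral_measure B r A = diag_op B (\<lambda>e. indicator A (r e))"

lemma bounded_indicator_image: "bounded ((\<lambda>e. indicator A (r e) :: complex) ` B)"
  by (rule boundedI[of _ 1]) (auto simp: indicator_def)

lemma nn_integral_count_space_has_sum:
  assumes "(f has_sum s) A" "\<And>x. x \<in> A \<Longrightarrow> 0 \<le> (f x :: real)"
  shows "(\<integral>\<^sup>+x. ennreal (f x) \<partial>count_space A) = ennreal s"
proof -
  have "f summable_on A" using assms(1) by (auto simp: summable_on_def)
  then have "Infinite_Set_Sum.abs_summable_on f A"
    using summable_on_iff_abs_summable_on_real abs_summable_equivalent by blast
  then show ?thesis
    using assms by (simp add: nn_integral_conv_infsetsum infsetsum_infsum infsumI)
qed

context
  fixes B :: "'a::chilbert_space set" and M :: "'b measure" and r :: "'a \<Rightarrow> 'b"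
  assumes onb: "orthonormal_basis B" and r_space: "\<And>e. e \<in> B \<Longrightarrow> r e \<in> space M"
begin

lemma diag_spectral_measure_coeff:
  "e \<in> B \<Longrightarrow> cinner e (diag_spectral_measure B r A x) = indicator A (r e) * cinner e x"
  unfolding diag_spectral_measure_def by (rule diag_op_coeff[OF onb bounded_indicator_image])

lemma diag_spectral_measure_has_sum:
  "((\<lambda>e. cinner e x *\<^sub>C e) has_sum diag_spectral_measure B r A x) {e \<in> B. r e \<in> A}"
  using diag_op_has_sum[OF onb bounded_indicator_image[of A r B], of x]
  unfolding diag_spectral_measure_def
  by (rule has_sum_cong_neutral[THEN iffD1, rotated 3]) auto

text \<open>Countable additivity is the regrouping of the basis expansion of \<open>x\<close> according to which \<open>A n\<close>
  contains \<open>r e\<close>.\<close>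

lemma projection_valued_diag_spectral_measure:
  "projection_valued_measure M (diag_spectral_measure B r)"
  unfolding projection_valued_measure_def
proof (intro conjI ballI allI impI)
  fix A assume "A \<in> sets M"
  show "selfadjoint (diag_spectral_measure B r A)"
    unfolding diag_spectral_measure_def
    by (rule selfadjoint_diag_op[OF onb bounded_indicator_image]) (simp add: indicator_def)
  show "diag_spectral_measure B r A \<circ> diag_spectral_measure B r A = diag_spectral_measure B r A"
    by (intro ext onb_eqI[OF onb]) (simp add: diag_spectral_measure_coeff indicator_def)
next
  show "diag_spectral_measure B r {} = (\<lambda>x. 0)" "diag_spectral_measure B r (space M) = id"
    by (intro ext onb_eqI[OF onb]; simp add: diag_spectral_measure_coeff r_space)+
next
  fix A A' assume "A \<in> sets M" "A' \<in> sets M"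
  show "diag_spectral_measure B r (A \<inter> A') = diag_spectral_measure B r A \<circ> diag_spectral_measure B r A'"
    by (intro ext onb_eqI[OF onb]) (simp add: diag_spectral_measure_coeff indicator_def)
next
  fix A :: "nat \<Rightarrow> 'b set" and x
  assume A: "range A \<subseteq> sets M \<and> disjoint_family A"
  define Q where "Q n = {e \<in> B. r e \<in> A n}" for n
  have inj: "inj_on snd (Sigma UNIV Q)"
  proof (rule inj_onI)
    fix p q assume pq: "p \<in> Sigma UNIV Q" "q \<in> Sigma UNIV Q" "snd p = snd q"
    then have "r (snd p) \<in> A (fst p) \<inter> A (fst q)" by (auto simp: Q_def)
    with A have "fst p = fst q" by (auto simp: disjoint_family_on_def)
    with pq show "p = q" by (simp add: prod_eq_iff)
  qed
  have "snd ` Sigma UNIV Q = {e \<in> B. r e \<in> (\<Union>n. A n)}"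
    by (force simp: Q_def)
  with diag_spectral_measure_has_sum[of x "\<Union>n. A n"]
  have "((\<lambda>p. cinner (snd p) x *\<^sub>C snd p) has_sum diag_spectral_measure B r (\<Union>n. A n) x) (Sigma UNIV Q)"
    using has_sum_reindex[OF inj, of "\<lambda>e. cinner e x *\<^sub>C e"] by (simp add: o_def)
  then have "((\<lambda>n. diag_spectral_measure B r (A n) x) has_sum diag_spectral_measure B r (\<Union>n. A n) x) UNIV"
    by (rule has_sum_SigmaD) (simp add: Q_def diag_spectral_measure_has_sum)
  then show "(\<lambda>n. diag_spectral_measure B r (A n) x) sums diag_spectral_measure B r (\<Union>n. A n) x"
    by (rule has_sum_imp_sums)
qed

text \<open>The scalar measures are purely atomic: the basis vector \<open>e\<close> contributes the mass
  \<open>\<bar>\<langle>e, x\<rangle>\<bar>\<^sup>2\<close> at \<open>r(e)\<close>. Integrals against them are therefore sums over the basis.\<close>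

lemma scalar_diag_spectral_measure:
  "scalar_measure M (diag_spectral_measure B r) x
    = distr (density (count_space B) (\<lambda>e. ennreal ((cmod (cinner e x))\<^sup>2))) M r" (is "_ = ?N")
proof -
  let ?D = "density (count_space B) (\<lambda>e. ennreal ((cmod (cinner e x))\<^sup>2))"
  have meas: "r \<in> measurable ?D M" using r_space by simp
  have "ennreal (Re (cinner x (diag_spectral_measure B r A x))) = emeasure ?N A" if "A \<in> sets M" for A
  proof -
    have "indicator A (r e) * complex_of_real ((cmod (cinner e x))\<^sup>2)
        = complex_of_real ((cmod (cinner e x))\<^sup>2 * indicator A (r e))" for e
      by (simp add: indicator_def)
    then have "((\<lambda>e. (cmod (cinner e x))\<^sup>2 * indicator A (r e)) has_sum
        Re (cinner x (diag_spectral_measure B r A x))) B"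
      using has_sum_Re[OF diag_op_form[OF onb bounded_indicator_image[of A r], of x]]
      unfolding diag_spectral_measure_def by (simp del: of_real_power of_real_mult)
    then have "ennreal (Re (cinner x (diag_spectral_measure B r A x)))
        = (\<integral>\<^sup>+e. ennreal ((cmod (cinner e x))\<^sup>2 * indicator A (r e)) \<partial>count_space B)"
      by (intro nn_integral_count_space_has_sum[symmetric]) (auto simp: indicator_def)
    also have "\<dots> = (\<integral>\<^sup>+e. ennreal ((cmod (cinner e x))\<^sup>2) * indicator (r -` A \<inter> B) e \<partial>count_space B)"
      by (intro nn_integral_cong) (auto simp: indicator_def)
    also have "\<dots> = emeasure ?N A"
      using that meas by (simp add: emeasure_distr emeasure_density)
    finally show ?thesis .
  qed
  then have "scalar_measure M (diag_spectral_measure B r) x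
      = measure_of (space M) (sets M) (emeasure ?N)"
    unfolding scalar_measure_def
    by (intro measure_of_eq) (auto simp: sets.space_closed sets.sigma_sets_eq)
  also have "\<dots> = ?N"
    using measure_of_of_measure[of ?N] by simp
  finally show ?thesis .
qed

lemma has_operator_integral_diag:
  assumes f: "f \<in> borel_measurable M" and bd: "bounded ((\<lambda>e. f (r e)) ` B)"
  shows "has_operator_integral M (diag_spectral_measure B r) f (diag_op B (\<lambda>e. f (r e)))"
  unfolding has_operator_integral_def
proof (intro conjI allI)
  show "bounded_clinear (diag_op B (\<lambda>e. f (r e)))"
    by (rule bounded_clinear_diag_op[OF onb bd])
  fix x :: 'a
  let ?w = "\<lambda>e. (cmod (cinner e x))\<^sup>2"
  let ?D = "density (count_space B) (\<lambda>e. ennreal (?w e))"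
  have meas: "r \<in> measurable ?D M" using r_space by simp
  obtain K where K: "\<And>e. e \<in> B \<Longrightarrow> cmod (f (r e)) \<le> K" using bd by (auto simp: bounded_iff)
  have "(\<lambda>e. norm (?w e *\<^sub>R f (r e))) summable_on B"
  proof (rule Infinite_Sum.abs_summable_on_comparison_test')
    show "(\<lambda>e. ?w e * K) summable_on B"
      using onb_Parseval_norm[OF onb, of x]
      by (intro summable_on_cmult_left) (auto simp: summable_on_def)
    show "norm (?w e *\<^sub>R f (r e)) \<le> ?w e * K" if "e \<in> B" for e
      using K[OF that] by (simp add: mult_left_mono)
  qed
  then have sm: "Infinite_Set_Sum.abs_summable_on (\<lambda>e. ?w e *\<^sub>R f (r e)) B"
    by (simp add: abs_summable_equivalent[symmetric])
  then have "integrable ?D (\<lambda>e. f (r e))"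
    by (simp add: integrable_density abs_summable_on_def)
  then have int: "integrable (distr ?D M r) f"
    by (simp add: integrable_distr_eq[OF meas f])
  have "integral\<^sup>L (distr ?D M r) f = integral\<^sup>L ?D (\<lambda>e. f (r e))"
    by (rule integral_distr[OF meas f])
  also have "\<dots> = (\<integral>e. ?w e *\<^sub>R f (r e) \<partial>count_space B)"
    by (simp add: integral_density)
  also have "\<dots> = infsum (\<lambda>e. ?w e *\<^sub>R f (r e)) B"
    using infsetsum_infsum[OF sm] by (simp add: infsetsum_def)
  also have "\<dots> = cinner x (diag_op B (\<lambda>e. f (r e)) x)"
    using diag_op_form[OF onb bd, of x]
    by (intro infsumI) (simp add: scaleR_conv_of_real mult.commute)
  finally show "integrable (scalar_measure M (diag_spectral_measure B r) x) f"
    and "cinner x (diag_op B (\<lambda>e. f (r e)) x)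
      = integral\<^sup>L (scalar_measure M (diag_spectral_measure B r) x) f"
    using int by (simp_all add: scalar_diag_spectral_measure)
qed

end

section \<open>Spectral integrals act on eigenvectors\<close>

context
  fixes M :: "'b measure" and E :: "'b set \<Rightarrow> 'a::chilbert_space \<Rightarrow> 'a"
  assumes pvm: "projection_valued_measure M E"
begin

lemma pvm_selfadjoint: "A \<in> sets M \<Longrightarrow> selfadjoint (E A)"
  using pvm by (auto simp: projection_valued_measure_def)

lemma pvm_Int: "A \<in> sets M \<Longrightarrow> A' \<in> sets M \<Longrightarrow> E A (E A' x) = E (A \<inter> A') x"
  using pvm unfolding projection_valued_measure_def by (metis comp_apply)

lemma pvm_empty: "E {} x = 0" and pvm_space: "E (space M) x = x"
  using pvm by (auto simp: projection_valued_measure_def)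

lemma pvm_sums:
  "range A \<subseteq> sets M \<Longrightarrow> disjoint_family A \<Longrightarrow> (\<lambda>n. E (A n) x) sums E (\<Union>n::nat. A n) x"
  using pvm by (auto simp: projection_valued_measure_def)

lemma pvm_Un:
  assumes "A \<in> sets M" "A' \<in> sets M" "A \<inter> A' = {}"
  shows "E (A \<union> A') x = E A x + E A' x"
proof -
  have "disjoint_family (binaryset A A')"
    using assms(3) by (auto simp: disjoint_family_on_def binaryset_def)
  then have "(\<lambda>n. E (binaryset A A' n) x) sums E (A \<union> A') x"
    using pvm_sums[of "binaryset A A'" x] assms by (simp add: range_binaryset_eq UN_binaryset_eq)
  moreover have "(\<lambda>n. E (binaryset A A' n) x) sums (\<Sum>n\<in>{0, 1}. E (binaryset A A' n) x)"
    by (rule sums_finite) (auto simp: binaryset_def pvm_empty)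
  ultimately show ?thesis by (simp add: sums_unique2 binaryset_def)
qed

lemma pvm_form: "A \<in> sets M \<Longrightarrow> cinner x (E A x) = complex_of_real ((norm (E A x))\<^sup>2)"
  using selfadjointD(2)[OF pvm_selfadjoint, of A x "E A x"]
  by (simp add: pvm_Int cinner_self)

lemma sets_scalar_measure [simp]: "sets (scalar_measure M E x) = sets M"
  and space_scalar_measure [simp]: "space (scalar_measure M E x) = space M"
  by (simp_all add: scalar_measure_def)

lemma emeasure_scalar_measure:
  assumes "A \<in> sets M"
  shows "emeasure (scalar_measure M E x) A = ennreal (Re (cinner x (E A x)))"
  unfolding scalar_measure_def
proof (rule emeasure_measure_of_sigma[OF sets.sigma_algebra_axioms _ _ assms])
  show "positive (sets M) (\<lambda>A. ennreal (Re (cinner x (E A x))))"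
    by (simp add: positive_def pvm_empty)
  show "countably_additive (sets M) (\<lambda>A. ennreal (Re (cinner x (E A x))))"
    unfolding countably_additive_def
  proof (intro allI impI)
    fix A :: "nat \<Rightarrow> 'b set"
    assume A: "range A \<subseteq> sets M" "disjoint_family A" "\<Union> (range A) \<in> sets M"
    have "(\<lambda>n. Re (cinner x (E (A n) x))) sums Re (cinner x (E (\<Union> (range A)) x))"
      by (intro bounded_linear.sums[OF bounded_linear_compose[OF bounded_linear_Re bounded_linear_cinner_right]]
          pvm_sums A)
    moreover have "0 \<le> Re (cinner x (E (A n) x))" for n
      using A(1) by (subst pvm_form) auto
    ultimately show "(\<Sum>n. ennreal (Re (cinner x (E (A n) x)))) = ennreal (Re (cinner x (E (\<Union> (range A)) x)))"
      by (intro suminf_ennreal_eq)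
  qed
qed

lemma finite_scalar_measure: "finite_measure (scalar_measure M E x)"
  by (rule finite_measureI) (simp add: emeasure_scalar_measure)

lemma measure_scalar_measure:
  "A \<in> sets M \<Longrightarrow> measure (scalar_measure M E x) A = (norm (E A x))\<^sup>2"
  by (simp add: measure_def emeasure_scalar_measure pvm_form)

text \<open>Both sides assign to \<open>C\<close> the number \<open>\<langle>x, E(A \<inter> C) x\<rangle>\<close>. So integrals at the projected vector
  \<open>E(A) x\<close> are integrals over \<open>A\<close> at \<open>x\<close>.\<close>

lemma scalar_measure_projection:
  assumes A: "A \<in> sets M"
  shows "scalar_measure M E (E A x) = density (scalar_measure M E x) (\<lambda>t. ennreal (indicator A t))"
    (is "_ = ?N")
proof -
  have "ennreal (Re (cinner (E A x) (E C (E A x)))) = emeasure ?N C" if C: "C \<in> sets M" for C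
  proof -
    have "cinner (E A x) (E C (E A x)) = cinner x (E (A \<inter> C) x)"
      using A C by (simp add: selfadjointD(2)[OF pvm_selfadjoint[OF A]] pvm_Int Int_ac)
    moreover have "emeasure ?N C = emeasure (scalar_measure M E x) (A \<inter> C)"
      unfolding ennreal_indicator using A C by (intro emeasure_restricted) simp_all
    ultimately show ?thesis
      using A C by (simp add: emeasure_scalar_measure)
  qed
  then have "scalar_measure M E (E A x) = measure_of (space M) (sets M) (emeasure ?N)"
    unfolding scalar_measure_def[of M E "E A x"]
    by (intro measure_of_eq) (auto simp: sets.space_closed sets.sigma_sets_eq)
  also have "\<dots> = ?N"
    using measure_of_of_measure[of ?N] by simp
  finally show ?thesis .
qed

lemma operator_integral_projection:
  assumes A: "A \<in> sets M" and S: "has_operator_integral M E f S"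
  shows "cinner (E A x) (S (E A x)) = (\<integral>t. indicator A t *\<^sub>R f t \<partial>scalar_measure M E x)"
proof -
  have f: "f \<in> borel_measurable (scalar_measure M E x)"
    using S unfolding has_operator_integral_def by (intro borel_measurable_integrable) blast
  have "cinner (E A x) (S (E A x)) = integral\<^sup>L (scalar_measure M E (E A x)) f"
    using S unfolding has_operator_integral_def by blast
  also have "\<dots> = (\<integral>t. indicator A t *\<^sub>R f t \<partial>scalar_measure M E x)"
    unfolding scalar_measure_projection[OF A]
    by (rule integral_density) (use f A in \<open>auto intro!: borel_measurable_indicator\<close>)
  finally show ?thesis .
qed

text \<open>The quadratic form of \<open>S\<close> splits along \<open>A\<close> and its complement, so \<open>S\<close> is the sum of its
  compressions to the ranges of \<open>E(A)\<close> and \<open>E(A\<^sup>c)\<close>.\<close>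

lemma operator_integral_commute:
  assumes A: "A \<in> sets M" and S: "has_operator_integral M E f S"
  shows "S (E A x) = E A (S x)"
proof -
  define A' where "A' = space M - A"
  have A': "A' \<in> sets M" using A by (simp add: A'_def)
  have Sc: "bounded_clinear S" using S by (simp add: has_operator_integral_def)
  note sa = pvm_selfadjoint[OF A] pvm_selfadjoint[OF A']
  have split: "S = (\<lambda>x. E A (S (E A x)) + E A' (S (E A' x)))"
  proof (rule clinear_eqI[OF Sc])
    show "bounded_clinear (\<lambda>x. E A (S (E A x)) + E A' (S (E A' x)))"
      by (rule bounded_clinear_add; rule bounded_clinear_compose, rule sa[THEN selfadjointD(1)],
          rule bounded_clinear_compose[OF Sc], rule sa[THEN selfadjointD(1)])
    fix x
    let ?\<mu> = "scalar_measure M E x"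
    have f: "integrable ?\<mu> f" using S by (simp add: has_operator_integral_def)
    have "cinner x (E A (S (E A x)) + E A' (S (E A' x)))
        = cinner (E A x) (S (E A x)) + cinner (E A' x) (S (E A' x))"
      by (simp add: cinner_add_right selfadjointD(2)[OF sa(1)] selfadjointD(2)[OF sa(2)])
    also have "\<dots> = (\<integral>t. indicator A t *\<^sub>R f t \<partial>?\<mu>) + (\<integral>t. indicator A' t *\<^sub>R f t \<partial>?\<mu>)"
      by (simp only: operator_integral_projection[OF A S] operator_integral_projection[OF A' S])
    also have "\<dots> = (\<integral>t. indicator A t *\<^sub>R f t + indicator A' t *\<^sub>R f t \<partial>?\<mu>)"
      using f A A' by (intro Bochner_Integration.integral_add[symmetric] integrable_mult_indicator) simp_all
    also have "\<dots> = integral\<^sup>L ?\<mu> f"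
      by (intro Bochner_Integration.integral_cong) (auto simp: A'_def indicator_def)
    also have "\<dots> = cinner x (S x)" using S by (simp add: has_operator_integral_def)
    finally show "cinner x (S x) = cinner x (E A (S (E A x)) + E A' (S (E A' x)))" ..
  qed
  have AA': "E A (E A' y) = 0" "E A' (E A y) = 0" "E A (E A y) = E A y" for y
    using A A' by (simp_all add: pvm_Int A'_def pvm_empty Int_Diff Diff_Int_distrib2)
  have "S (E A x) = E A (S (E A (E A x))) + E A' (S (E A' (E A x)))"
    by (subst split) simp
  also have "\<dots> = E A (S (E A x))"
    by (simp add: AA' bounded_clinearD[OF Sc] bounded_clinearD[OF selfadjointD(1)[OF sa(2)]])
  also have "\<dots> = E A (E A (S (E A x)) + E A' (S (E A' x)))"
    by (simp add: AA' bounded_clinearD[OF selfadjointD(1)[OF sa(1)]])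
  also have "\<dots> = E A (S x)"
    by (subst (3) split) simp
  finally show ?thesis .
qed

text \<open>Let \<open>h\<close> stay strictly on one side of the eigenvalue \<open>l\<close> on \<open>A\<close>; the sign of \<open>s\<close> tells on which.
  Since \<open>T\<close> commutes with \<open>E(A)\<close>, the vector \<open>y = E(A) e\<close> satisfies \<open>T y = l y\<close>, so
  \<open>\<integral>\<^sub>A (h - l) d\<mu>\<^sub>y = 0\<close> with an integrand of constant sign. Hence \<open>\<mu>\<^sub>y(A) = \<parallel>y\<parallel>\<^sup>2\<close> vanishes.\<close>

lemma eigenvector_projection_zero:
  fixes h :: "'b \<Rightarrow> real" and s :: real
  assumes T: "has_operator_integral M E (\<lambda>t. complex_of_real (h t)) T"
    and e: "T e = complex_of_real l *\<^sub>C e"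
    and A: "A \<in> sets M" and sgn: "\<And>t. t \<in> A \<Longrightarrow> 0 < s * (h t - l)"
  shows "E A e = 0"
proof -
  define y where "y = E A e"
  let ?\<mu> = "scalar_measure M E y"
  interpret finite_measure ?\<mu> by (rule finite_scalar_measure)
  have yA: "E A y = y" using A by (simp add: y_def pvm_Int)
  have Ty: "T y = complex_of_real l *\<^sub>C y"
    unfolding y_def operator_integral_commute[OF A T] e
    by (rule bounded_clinearD[OF selfadjointD(1)[OF pvm_selfadjoint[OF A]]])
  have h: "integrable ?\<mu> h"
    using T by (simp add: has_operator_integral_def complex_of_real_integrable_eq)
  have hA: "integrable ?\<mu> (\<lambda>t. indicator A t *\<^sub>R h t)" 
    using h A by (intro integrable_mult_indicator) simp_all
  have cA: "integrable ?\<mu> (\<lambda>t. indicator A t *\<^sub>R l)" 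
    using A by (intro integrable_mult_indicator) simp_all
  have "complex_of_real (l * (norm y)\<^sup>2) = cinner (E A y) (T (E A y))"
    by (simp add: yA Ty cinner_scaleC_right cinner_self)
  also have "\<dots> = (\<integral>t. indicator A t *\<^sub>R complex_of_real (h t) \<partial>?\<mu>)"
    by (rule operator_integral_projection[OF A T])
  also have "\<dots> = (\<integral>t. complex_of_real (indicator A t *\<^sub>R h t) \<partial>?\<mu>)"
    by (simp add: scaleR_conv_of_real)
  also have "\<dots> = complex_of_real (\<integral>t. indicator A t *\<^sub>R h t \<partial>?\<mu>)"
    by (rule integral_complex_of_real)
  finally have hI: "(\<integral>t. indicator A t *\<^sub>R h t \<partial>?\<mu>) = l * (norm y)\<^sup>2"
    by (simp only: of_real_eq_iff)
  have "(\<integral>t. indicator A t *\<^sub>R l \<partial>?\<mu>) = measure ?\<mu> A * l"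
    using A by simp
  then have cI: "(\<integral>t. indicator A t *\<^sub>R l \<partial>?\<mu>) = l * (norm y)\<^sup>2"
    by (simp add: measure_scalar_measure[OF A] yA)
  let ?g = "\<lambda>t. s * (indicator A t *\<^sub>R h t - indicator A t *\<^sub>R l)"
  have g: "integrable ?\<mu> ?g"
    by (intro integrable_mult_right Bochner_Integration.integrable_diff hA cA)
  have "integral\<^sup>L ?\<mu> ?g = 0"
    unfolding integral_mult_right_zero Bochner_Integration.integral_diff[OF hA cA] hI cI by simp
  moreover have "?g t \<ge> 0" for t
    using sgn[of t] by (simp add: indicator_def less_imp_le)
  ultimately have "AE t in ?\<mu>. ?g t = 0"
    using integral_nonneg_eq_0_iff_AE[OF g] by simp
  then have "AE t in ?\<mu>. t \<notin> A"
    by (rule AE_mp) (intro AE_I2, use sgn in \<open>force simp: indicator_def\<close>)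
  then have "measure ?\<mu> A = 0"
    using A by (intro measure_eq_0_null_sets) (simp add: AE_iff_null_sets)
  then show ?thesis
    using measure_scalar_measure[OF A, of y] yA by (simp add: y_def)
qed

text \<open>The sets where \<open>h\<close> exceeds, respectively stays below, the eigenvalue \<open>h(u)\<close> annihilate \<open>e\<close>. As \<open>h\<close> is
  injective, only the point \<open>u\<close> remains, so \<open>E({u}) e = e\<close>; and on the range of \<open>E({u})\<close> the integral
  of \<open>f\<close> acts as multiplication by \<open>f(u)\<close>.\<close>

lemma operator_integral_eigenvector:
  fixes h :: "'b \<Rightarrow> real"
  assumes T: "has_operator_integral M E (\<lambda>t. complex_of_real (h t)) T"
    and h: "h \<in> borel_measurable M" and inj: "inj_on h (space M)"
    and S: "has_operator_integral M E f S"
    and e: "T e = complex_of_real (h u) *\<^sub>C e" and u: "u \<in> space M"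
  shows "S e = f u *\<^sub>C e"
proof -
  define G L where "G = {t \<in> space M. h u < h t}" and "L = {t \<in> space M. h t < h u}"
  have GL: "G \<in> sets M" "L \<in> sets M"
    unfolding G_def L_def using h by measurable
  define A where "A = {u}"
  have A_eq: "A = space M - (G \<union> L)"
  proof -
    have "t = u \<or> h u < h t \<or> h t < h u" if "t \<in> space M" for t
      using that u inj by (metis inj_onD linorder_less_linear)
    then show ?thesis using u unfolding A_def G_def L_def by blast
  qed
  have A: "A \<in> sets M" unfolding A_eq using GL by simp
  have "E G e = 0" by (rule eigenvector_projection_zero[OF T e GL(1), of 1]) (simp add: G_def)
  moreover have "E L e = 0"
    by (rule eigenvector_projection_zero[OF T e GL(2), of "- 1"]) (simp add: L_def)
  moreover have "E (G \<union> L) e = E G e + E L e"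
    by (rule pvm_Un) (use GL in \<open>auto simp: G_def L_def\<close>)
  moreover have "E (A \<union> (G \<union> L)) e = E A e + E (G \<union> L) e"
    by (rule pvm_Un) (use GL A in \<open>auto simp: A_eq\<close>)
  moreover have "A \<union> (G \<union> L) = space M"
    unfolding A_eq using GL sets.sets_into_space by blast
  ultimately have Ae: "E A e = e" by (simp add: pvm_space)
  have Sc: "bounded_clinear S" using S by (simp add: has_operator_integral_def)
  note EA = pvm_selfadjoint[OF A]
  have "(\<lambda>x. S (E A x)) = (\<lambda>x. f u *\<^sub>C E A x)"
  proof (rule clinear_eqI)
    show "bounded_clinear (\<lambda>x. S (E A x))"
      by (rule bounded_clinear_compose[OF Sc selfadjointD(1)[OF EA]])
    show "bounded_clinear (\<lambda>x. f u *\<^sub>C E A x)"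
      by (rule bounded_clinear_scaleC[OF selfadjointD(1)[OF EA]])
    fix x
    let ?\<mu> = "scalar_measure M E x"
    have "S (E A x) = E A (S (E A x))"
      using A by (simp flip: operator_integral_commute[OF A S] add: pvm_Int)
    then have "cinner x (S (E A x)) = cinner (E A x) (S (E A x))"
      by (metis selfadjointD(2)[OF EA])
    also have "\<dots> = (\<integral>t. indicator A t *\<^sub>R f t \<partial>?\<mu>)"
      by (rule operator_integral_projection[OF A S])
    also have "\<dots> = (\<integral>t. indicator A t *\<^sub>R f u \<partial>?\<mu>)"
      by (intro Bochner_Integration.integral_cong) (auto simp: A_def indicator_def)
    also have "\<dots> = measure ?\<mu> A *\<^sub>R f u"
      using A finite_measure.emeasure_finite[OF finite_scalar_measure]
      by (intro has_bochner_integral_integral_eq has_bochner_integral_indicator)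
         (simp_all add: top.not_eq_extremum)
    also have "\<dots> = cinner x (f u *\<^sub>C E A x)"
      using A by (simp add: measure_scalar_measure cinner_scaleC_right pvm_form scaleR_conv_of_real mult.commute)
    finally show "cinner x (S (E A x)) = cinner x (f u *\<^sub>C E A x)" .
  qed
  from fun_cong[OF this, of e] show ?thesis by (simp add: Ae)
qed

end

section \<open>The functional calculus of a diagonal operator\<close>

text \<open>Existence comes from the diagonal spectral measure. For uniqueness, an arbitrary spectral measure
  of \<open>T\<close> gives an operator that maps each eigenvector \<open>e\<close> in \<open>B\<close> to \<open>\<phi>(r(e)) e\<close>, and this
  determines a bounded operator.\<close>

lemma functional_calculus_diag_op:
  fixes \<phi> :: "real \<Rightarrow> complex" and r :: "'a::chilbert_space \<Rightarrow> real"
  assumes B: "orthonormal_basis B" and bd: "bounded ((\<lambda>e. complex_of_real (r e)) ` B)"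
    and T: "T = diag_op B (\<lambda>e. complex_of_real (r e))"
    and \<phi>: "\<phi> \<in> borel_measurable (spectrum_borel T)" and bd\<phi>: "bounded ((\<lambda>e. \<phi> (r e)) ` B)"
  shows "functional_calculus \<phi> T = diag_op B (\<lambda>e. \<phi> (r e))"
proof -
  let ?M = "spectrum_borel T"
  have Tc: "bounded_clinear T" unfolding T by (rule bounded_clinear_diag_op[OF B bd])
  have Te: "T e = complex_of_real (r e) *\<^sub>C e" if "e \<in> B" for e
    unfolding T by (rule diag_op_basis[OF B bd that])
  have r_space: "r e \<in> space ?M" if "e \<in> B" for e
  proof -
    have "norm e = 1"
      using that orthonormal_basis_imp_orthonormal[OF B] by (simp add: orthonormal_def)
    then have "e \<noteq> 0" by auto
    with eigenvalue_in_spectrum[OF Tc Te[OF that]] show ?thesis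
      by (simp add: spectrum_borel_def space_restrict_space)
  qed
  have meas: "(\<lambda>t. t) \<in> borel_measurable ?M"
    unfolding spectrum_borel_def by (rule measurable_restrict_space1) simp
  have "spectral_measure T (diag_spectral_measure B r)"
    unfolding spectral_measure_def
    using projection_valued_diag_spectral_measure[where M = ?M, OF B r_space]
      has_operator_integral_diag[where M = ?M and f = complex_of_real, OF B r_space _ bd] meas
    by (simp add: T[symmetric])
  moreover have "has_operator_integral ?M (diag_spectral_measure B r) \<phi> (diag_op B (\<lambda>e. \<phi> (r e)))"
    by (rule has_operator_integral_diag[OF B r_space \<phi> bd\<phi>])
  ultimately have ex: "\<exists>E. spectral_measure T E \<and> has_operator_integral ?M E \<phi> (diag_op B (\<lambda>e. \<phi> (r e)))"
    by blast
  have uniq: "S = diag_op B (\<lambda>e. \<phi> (r e))"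
    if "\<exists>E. spectral_measure T E \<and> has_operator_integral ?M E \<phi> S" for S
  proof -
    from that obtain E where pvm: "projection_valued_measure ?M E"
      and TE: "has_operator_integral ?M E complex_of_real T" and SE: "has_operator_integral ?M E \<phi> S"
      unfolding spectral_measure_def by blast
    have "S e = \<phi> (r e) *\<^sub>C e" if "e \<in> B" for e
      by (rule operator_integral_eigenvector[OF pvm TE meas inj_on_id2 SE Te[OF that] r_space[OF that]])
    then show ?thesis
      using SE diagonal_eq_diag_op(2)[OF B] by (simp add: has_operator_integral_def)
  qed
  show ?thesis
    unfolding functional_calculus_def by (rule the_equality) (fact ex, fact uniq)
qed

section \<open>The trace inequality\<close>

text \<open>This places the spectrum inside the interval on which \<open>\<phi>\<close> is measurable.\<close>

lemma spectrum_diag_op_unit_interval: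
  assumes B: "orthonormal_basis B" and r: "\<And>e. e \<in> B \<Longrightarrow> 0 \<le> r e \<and> r e \<le> (1::real)"
    and t: "complex_of_real t \<in> spectrum (diag_op B (\<lambda>e. complex_of_real (r e)))"
  shows "t \<in> {0..1}"
proof (rule ccontr)
  assume "t \<notin> {0..1}"
  define d where "d = max (- t) (t - 1)"
  have "0 < d" using \<open>t \<notin> {0..1}\<close> by (auto simp: d_def)
  moreover have "d \<le> cmod (complex_of_real (r e) - complex_of_real t)" if "e \<in> B" for e
    using r[OF that] unfolding of_real_diff[symmetric] norm_of_real by (auto simp: d_def)
  moreover have "bounded ((\<lambda>e. complex_of_real (r e)) ` B)"
    by (rule boundedI[of _ 1]) (use r in auto)
  ultimately show False using not_in_spectrum_diag_op[OF B] t by blast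
qed

text \<open>The quotient covers \<open>0 < t < 1\<close>; at both endpoints the two sides vanish, at \<open>0\<close> because
  \<open>\<phi>(0) = 0\<close>.\<close>

lemma C_const_bound:
  assumes bdd: "bdd_above (C_quotient \<phi> ` {0<..<1})" and "\<phi> 0 = 0" and "0 \<le> t" "t \<le> 1"
  shows "cmod (\<phi> t - \<phi> 1 * complex_of_real t) \<le> C_const \<phi> * (t * (1 - t))"
proof (cases "t = 0 \<or> t = 1")
  case False
  with assms(3,4) have t: "t \<in> {0<..<1}" by auto
  then have "C_quotient \<phi> t \<le> C_const \<phi>"
    unfolding C_const_def by (intro cSUP_upper bdd)
  moreover have "0 < t * (1 - t)" using t by simp
  ultimately show ?thesis by (simp add: C_quotient_def pos_divide_le_eq)
qed (use \<open>\<phi> 0 = 0\<close> in auto)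

lemma C_const_nonneg:
  assumes "bdd_above (C_quotient \<phi> ` {0<..<1})"
  shows "0 \<le> C_const \<phi>"
proof -
  have "0 \<le> C_quotient \<phi> (1 / 2)" by (simp add: C_quotient_def)
  also have "\<dots> \<le> C_const \<phi>" unfolding C_const_def by (intro cSUP_upper assms) simp
  finally show ?thesis .
qed

theorem lemma1p1:
  fixes T :: "'a::chilbert_space \<Rightarrow> 'a" and \<phi> :: "real \<Rightarrow> complex"
  assumes "positive_op T" and "trace_class T" and "onorm T \<le> 1"
    and "\<phi> \<in> borel_measurable (restrict_space borel {0..1})"
    and "\<phi> 0 = 0"
    and "bdd_above (C_quotient \<phi> ` {0<..<1})"
  shows "trace_class (functional_calculus \<phi> T) \<and>
    cmod (op_trace (functional_calculus \<phi> T) - \<phi> 1 * op_trace T)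
      \<le> C_const \<phi> * Re (op_trace (\<lambda>x. T x - T (T x)))"
proof -
  obtain B r where B: "orthonormal_basis B" and T: "T = diag_op B (\<lambda>e. complex_of_real (r e))"
    and bd: "bounded ((\<lambda>e. complex_of_real (r e)) ` B)"
    and Te: "\<And>e. e \<in> B \<Longrightarrow> T e = complex_of_real (r e) *\<^sub>C e"
    and r0: "\<And>e. e \<in> B \<Longrightarrow> 0 \<le> r e" and sr: "r summable_on B"
    using positive_trace_class_diagonal[OF assms(1,2)] by metis
  note Tc = bounded_clinearD[OF positive_opD(2)[OF assms(1)]]
  define C where "C = C_const \<phi>"
  have C0: "0 \<le> C" unfolding C_def by (rule C_const_nonneg[OF assms(6)])
  have r1: "r e \<le> 1" if "e \<in> B" for e
  proof -
    have "norm e = 1"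
      using that orthonormal_basis_imp_orthonormal[OF B] by (simp add: orthonormal_def)
    with onorm[OF Tc(1), of e] r0[OF that] assms(3) show ?thesis
      by (simp add: Te[OF that] norm_scaleC)
  qed
  have C: "cmod (\<phi> (r e) - \<phi> 1 * complex_of_real (r e)) \<le> C * (r e - r e * r e)" if "e \<in> B" for e
    using C_const_bound[OF assms(6,5) r0[OF that] r1[OF that]]
    by (simp add: C_def right_diff_distrib)
  \<comment> \<open>Linear growth of \<open>\<phi>\<close> at \<open>0\<close> makes the entries \<open>\<phi>(r(e))\<close> summable along with the \<open>r(e)\<close>.\<close>
  define K where "K = cmod (\<phi> 1) + C"
  have \<phi>K: "cmod (\<phi> (r e)) \<le> r e * K" if "e \<in> B" for e
  proof -
    have "cmod (\<phi> (r e)) \<le> cmod (\<phi> (r e) - \<phi> 1 * complex_of_real (r e)) + cmod (\<phi> 1 * complex_of_real (r e))"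
      by (metis diff_add_cancel norm_triangle_ineq)
    also have "\<dots> \<le> C * (r e - r e * r e) + cmod (\<phi> 1) * r e"
      using C[OF that] r0[OF that] by (simp add: norm_mult)
    also have "\<dots> \<le> C * r e + cmod (\<phi> 1) * r e"
      using C0 by (intro add_right_mono mult_left_mono) simp_all
    finally show ?thesis by (simp add: K_def algebra_simps)
  qed
  have bd\<phi>: "bounded ((\<lambda>e. \<phi> (r e)) ` B)"
  proof -
    have "0 \<le> K" using C0 by (simp add: K_def)
    then have "cmod (\<phi> (r e)) \<le> K" if "e \<in> B" for e
      using \<phi>K[OF that] mult_right_mono[OF r1[OF that], of K] by simp
    then show ?thesis by (auto simp: bounded_iff)
  qed
  have abs\<phi>: "(\<lambda>e. cmod (\<phi> (r e))) summable_on B"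
    by (rule summable_on_comparison_test[OF summable_on_cmult_left[OF sr]]) (use \<phi>K in auto)
  have "\<phi> \<in> borel_measurable (spectrum_borel T)"
    unfolding spectrum_borel_def
    by (rule measurable_restrict_mono[OF assms(4)])
       (use spectrum_diag_op_unit_interval[OF B] r0 r1 T in blast)
  then have \<phi>T: "functional_calculus \<phi> T = diag_op B (\<lambda>e. \<phi> (r e))"
    by (rule functional_calculus_diag_op[OF B bd T _ bd\<phi>])

  obtain s t where s: "((\<lambda>e. \<phi> (r e)) has_sum s) B" and t: "(r has_sum t) B"
    using abs_summable_summable[OF abs\<phi>] sr by (auto simp: summable_on_def)
  have tr\<phi>: "op_trace (functional_calculus \<phi> T) = s"
    unfolding \<phi>T by (rule op_trace_diag_op[OF B bd\<phi> s abs\<phi>])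
  have absr: "(\<lambda>e. cmod (complex_of_real (r e))) summable_on B"
    by (rule summable_on_comparison_test[OF sr]) (use r0 in auto)
  have trT: "op_trace T = complex_of_real t"
    unfolding T by (rule op_trace_diag_op[OF B bd has_sum_of_real[OF t] absr])

  define q where "q e = r e - r e * r e" for e
  have q0: "0 \<le> q e" and qr: "q e \<le> r e" if "e \<in> B" for e
    using r0[OF that] r1[OF that] by (simp_all add: q_def mult_left_le)
  have sq: "q summable_on B"
    by (rule summable_on_comparison_test[OF sr]) (use qr q0 in auto)
  then obtain u where u: "(q has_sum u) B" by (auto simp: summable_on_def)
  have Dc: "bounded_clinear (\<lambda>x. T x - T (T x))"
    by (intro bounded_clinear_diff bounded_clinear_compose[of T T] positive_opD(2) assms(1))
  have De: "T e - T (T e) = complex_of_real (q e) *\<^sub>C e" if "e \<in> B" for e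
    by (simp add: Te[OF that] Tc scaleC_scaleC q_def scaleC_diff_left)
  have bdq: "bounded ((\<lambda>e. complex_of_real (q e)) ` B)"
    by (rule diagonal_eq_diag_op(1)[OF B Dc De])
  have TT: "(\<lambda>x. T x - T (T x)) = diag_op B (\<lambda>e. complex_of_real (q e))"
    by (rule diagonal_eq_diag_op(2)[OF B Dc De])
  have absq: "(\<lambda>e. cmod (complex_of_real (q e))) summable_on B"
    by (rule summable_on_comparison_test[OF sq]) (use q0 in auto)
  have trTT: "op_trace (\<lambda>x. T x - T (T x)) = complex_of_real u"
    unfolding TT by (rule op_trace_diag_op[OF B bdq has_sum_of_real[OF u] absq])

  have "cmod (s - \<phi> 1 * complex_of_real t) \<le> C * u"
  proof (rule norm_infsum_le)
    show "((\<lambda>e. \<phi> (r e) - \<phi> 1 * complex_of_real (r e)) has_sum (s - \<phi> 1 * complex_of_real t)) B"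
      using has_sum_add[OF s has_sum_uminusI[OF has_sum_cmult_right[OF has_sum_of_real[OF t], of "\<phi> 1"]]]
      by simp
    show "((\<lambda>e. C * q e) has_sum (C * u)) B" by (rule has_sum_cmult_right[OF u])
  qed (simp add: C q_def)
  moreover have "trace_class (functional_calculus \<phi> T)"
    unfolding \<phi>T by (rule trace_class_diag_op[OF B bd\<phi> abs\<phi>])
  ultimately show ?thesis
    by (simp add: tr\<phi> trT trTT C_def)
qed

end
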